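(* Let $R$ be a unital ring and let $E$ be a directed graph. If $R$ is von Neumann regular, then the Leavitt path algebra $L_R(E)$ is semiprimitive and semiprime.
   Context: Rings are associative, not necessarily unital and not necessarily commutative; a ring is called unital if it has a non-zero multiplicative identity. A ring $R$ is von Neumann regular if for every $x\in R$ there is $y\in R$ with $x=xyx$. A ring $S$ is semiprimitive if its Jacobson radical $J(S)$ (in the standard sense for not necessarily unital rings) is zero. A ring $S$ is semiprime if for every $a\in S$, $aSa=\{0\}$ implies $a=0$. A directed graph $E=(E^0,E^1,s,r)$ consists of a vertex set $E^0$, an edge set $E^1$ (of arbitrary cardinality, possibly empty) and maps $s,r\colon E^1\to E^0$. A vertex $v$ is regular if $s^{-1}(v)$ is non-empty and finite; $\mathrm{Reg}(E)$ is the set of regular vertices. The Leavitt path algebra $L_R(E)$ is the (not necessarily unital) free $R$-algebra generated by the symbols $\{v\mid v\in E^0\}\cup\{f\mid f\in E^1\}\cup\{f^*\mid f\in E^1\}$, where elements of $R$ commute with the generators, subject to the relations: (i) $vv'=\delta_{v,v'}v$ for $v,v'\in E^0$; (ii) $s(f)f=f=fr(f)$ for $f\in E^1$; (iii) $r(f)f^*=f^*=f^*s(f)$ for $f\in E^1$; (iv) $f^*f'=\delta_{f,f'}r(f)$ for $f,f'\in E^1$; (v) $v=\sum_{f\in s^{-1}(v)}ff^*$ for all $v\in\mathrm{Reg}(E)$. *)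

theory Defs
  imports
    "HOL-Algebra.QuotRing"
    "HOL-Library.Poly_Mapping"
    "Graph_Theory.Digraph"
begin

section \<open>Rings without identity\<close>

text \<open>
  Rings that need not have an identity are represented by the ring records of HOL-Algebra; the
  field \<open>one\<close> is never looked at and carries no meaning.
\<close>

locale nonunital_ring = abelian_group S for S (structure) +
  assumes rng_m_closed: "\<lbrakk>x \<in> carrier S; y \<in> carrier S\<rbrakk> \<Longrightarrow> x \<otimes> y \<in> carrier S"
    and rng_m_assoc: "\<lbrakk>x \<in> carrier S; y \<in> carrier S; z \<in> carrier S\<rbrakk>
      \<Longrightarrow> (x \<otimes> y) \<otimes> z = x \<otimes> (y \<otimes> z)"
    and rng_l_distr: "\<lbrakk>x \<in> carrier S; y \<in> carrier S; z \<in> carrier S\<rbrakk>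
      \<Longrightarrow> (x \<oplus> y) \<otimes> z = x \<otimes> z \<oplus> y \<otimes> z"
    and rng_r_distr: "\<lbrakk>x \<in> carrier S; y \<in> carrier S; z \<in> carrier S\<rbrakk>
      \<Longrightarrow> z \<otimes> (x \<oplus> y) = z \<otimes> x \<oplus> z \<otimes> y"

lemma (in nonunital_ring) nonunital_ring_Quot:
  assumes I: "additive_subgroup I S"
    and l: "\<And>a x. \<lbrakk>a \<in> carrier S; x \<in> I\<rbrakk> \<Longrightarrow> a \<otimes> x \<in> I"
    and r: "\<And>a x. \<lbrakk>a \<in> carrier S; x \<in> I\<rbrakk> \<Longrightarrow> x \<otimes> a \<in> I"
  shows "nonunital_ring (S Quot I)"
proof -
  interpret abelian_subgroup I S
    by (rule abelian_subgroupI3[OF I]) (rule abelian_group_axioms)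
  note sub = a_Hcarr
  have mem: "x \<in> I +> y \<longleftrightarrow> (\<exists>h\<in>I. x = h \<oplus> y)" for x y
    by (auto simp: a_r_coset_def r_coset_def)
  have mult: "rcoset_mult S I (I +> x) (I +> y) = I +> (x \<otimes> y)"
    if xy: "x \<in> carrier S" "y \<in> carrier S" for x y
  proof -
    have eq: "I +> (a \<otimes> b) = I +> (x \<otimes> y)" if ab: "a \<in> I +> x" "b \<in> I +> y" for a b
    proof -
      from ab obtain h k where h: "h \<in> I" "a = h \<oplus> x" and k: "k \<in> I" "b = k \<oplus> y"
        by (auto simp: mem)
      have c: "h \<in> carrier S" "k \<in> carrier S" using h k sub by auto
      have "a \<otimes> b = (h \<otimes> k \<oplus> h \<otimes> y \<oplus> x \<otimes> k) \<oplus> x \<otimes> y"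
        using h k c xy by (simp add: rng_l_distr rng_r_distr rng_m_closed a_ac)
      moreover have "h \<otimes> k \<oplus> h \<otimes> y \<oplus> x \<otimes> k \<in> I"
        using h k c xy by (intro a_closed l r) auto
      ultimately have "a \<otimes> b \<in> I +> (x \<otimes> y)" by (auto simp: mem)
      then show ?thesis
        using a_repr_independence' xy rng_m_closed by metis
    qed
    have "x \<in> I +> x" "y \<in> I +> y" using xy a_rcos_self by auto
    with eq show ?thesis unfolding rcoset_mult_def by blast
  qed
  have ag: "abelian_group (S Quot I)"
    by (rule comm_group_abelian_groupI)
      (simp add: FactRing_def a_factorgroup_is_comm_group[unfolded A_FactGroup_def'])
  interpret Q: abelian_group "S Quot I" by (rule ag)
  show ?thesis
    by unfold_locales
      (auto simp: FactRing_simps mult a_rcos_sum rng_m_closed rng_m_assoc rng_l_distr rng_r_distr)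
qed

definition is_left_ideal :: "('a, 'm) ring_scheme \<Rightarrow> 'a set \<Rightarrow> bool" where
  "is_left_ideal S M \<longleftrightarrow> additive_subgroup M S \<and>
     (\<forall>a\<in>carrier S. \<forall>x\<in>M. a \<otimes>\<^bsub>S\<^esub> x \<in> M)"

text \<open>
  Modular (also called regular) means that \<open>S\<close> has a right identity modulo \<open>M\<close>. This is automatic
  in a unital ring. A left ideal containing a modular one is itself modular, so that being maximal
  among the proper left ideals and being maximal among the proper modular ones agree.
\<close>

definition is_modular_left_ideal :: "('a, 'm) ring_scheme \<Rightarrow> 'a set \<Rightarrow> bool" where
  "is_modular_left_ideal S M \<longleftrightarrow> is_left_ideal S M \<and>
     (\<exists>e\<in>carrier S. \<forall>x\<in>carrier S. x \<ominus>\<^bsub>S\<^esub> x \<otimes>\<^bsub>S\<^esub> e \<in> M)"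

definition is_maximal_left_ideal :: "('a, 'm) ring_scheme \<Rightarrow> 'a set \<Rightarrow> bool" where
  "is_maximal_left_ideal S M \<longleftrightarrow> is_left_ideal S M \<and> M \<noteq> carrier S \<and>
     (\<forall>N. is_left_ideal S N \<and> M \<subseteq> N \<longrightarrow> N = M \<or> N = carrier S)"

text \<open>
  If there are no modular maximal left ideals, the radical is the whole ring.
\<close>

definition jacobson_radical :: "('a, 'm) ring_scheme \<Rightarrow> 'a set" where
  "jacobson_radical S = {a \<in> carrier S.
     \<forall>M. is_maximal_left_ideal S M \<and> is_modular_left_ideal S M \<longrightarrow> a \<in> M}"

definition semiprimitive :: "('a, 'm) ring_scheme \<Rightarrow> bool" where
  "semiprimitive S \<longleftrightarrow> jacobson_radical S = {\<zero>\<^bsub>S\<^esub>}"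

definition semiprime :: "('a, 'm) ring_scheme \<Rightarrow> bool" where
  "semiprime S \<longleftrightarrow> (\<forall>a\<in>carrier S.
     (\<lambda>x. a \<otimes>\<^bsub>S\<^esub> x \<otimes>\<^bsub>S\<^esub> a) ` carrier S = {\<zero>\<^bsub>S\<^esub>} \<longrightarrow> a = \<zero>\<^bsub>S\<^esub>)"


section \<open>The free algebra on the vertices, edges and ghost edges\<close>

datatype ('v, 'e) lpa_gen = Vertex 'v | Edge 'e | Ghost 'e

text \<open>
  Words form an additively written monoid under concatenation, so that finitely supported maps
  from words to the coefficient ring multiply by convolution.
\<close>

datatype 'g word = Word (letters: "'g list")

instantiation word :: (type) monoid_add
begin

definition zero_word :: "'g word" where
  "zero_word = Word []"

definition plus_word :: "'g word \<Rightarrow> 'g word \<Rightarrow> 'g word" where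
  "plus_word u w = Word (letters u @ letters w)"

instance
  by standard (simp_all add: zero_word_def plus_word_def)

end

type_synonym ('v, 'e, 'r) free_alg = "('v, 'e) lpa_gen word \<Rightarrow>\<^sub>0 'r"

definition lpa_gens :: "('v, 'e) pre_digraph \<Rightarrow> ('v, 'e) lpa_gen set" where
  "lpa_gens E = Vertex ` verts E \<union> Edge ` arcs E \<union> Ghost ` arcs E"

text \<open>
  Only nonempty words occur: the free algebra has no identity, and elements of the coefficient
  ring do not belong to it. Coefficients multiply past words, i.e. they commute with the generators.
  The unit \<open>1\<close> of the surrounding type is the empty word, which lies outside the carrier.
\<close>

definition free_alg_carrier :: "('v, 'e) pre_digraph \<Rightarrow> ('v, 'e, 'r::ring_1) free_alg set" where
  "free_alg_carrier E = {p. \<forall>w\<in>Poly_Mapping.keys p. letters w \<noteq> [] \<and> set (letters w) \<subseteq> lpa_gens E}"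

definition free_alg_ring :: "('v, 'e) pre_digraph \<Rightarrow> ('v, 'e, 'r::ring_1) free_alg ring" where
  "free_alg_ring E =
     \<lparr>carrier = free_alg_carrier E, mult = (*), one = 1, zero = 0, add = (+)\<rparr>"

definition gen_word :: "('v, 'e) lpa_gen list \<Rightarrow> ('v, 'e, 'r::ring_1) free_alg" where
  "gen_word gs = Poly_Mapping.single (Word gs) 1"

definition lpa_scalar :: "'r \<Rightarrow> ('v, 'e, 'r::ring_1) free_alg" where
  "lpa_scalar r = Poly_Mapping.single 0 r"


section \<open>The Leavitt path algebra\<close>

text \<open>
  The source map is \<^const>\<open>tail\<close>, the range map is \<^const>\<open>head\<close>, and \<^term>\<open>out_arcs E v\<close> is the
  set of edges with source \<open>v\<close>.
\<close>

definition regular_vertices :: "('v, 'e) pre_digraph \<Rightarrow> 'v set" where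
  "regular_vertices E = {v \<in> verts E. out_arcs E v \<noteq> {} \<and> finite (out_arcs E v)}"

inductive_set lpa_relations :: "('v, 'e) pre_digraph \<Rightarrow> ('v, 'e, 'r::ring_1) free_alg set"
  for E :: "('v, 'e) pre_digraph" where
  vertex_vertex: "\<lbrakk>v \<in> verts E; v' \<in> verts E\<rbrakk> \<Longrightarrow>
    gen_word [Vertex v, Vertex v'] - (if v = v' then gen_word [Vertex v] else 0) \<in> lpa_relations E"
| source_edge: "f \<in> arcs E \<Longrightarrow>
    gen_word [Vertex (tail E f), Edge f] - gen_word [Edge f] \<in> lpa_relations E"
| edge_range: "f \<in> arcs E \<Longrightarrow>
    gen_word [Edge f, Vertex (head E f)] - gen_word [Edge f] \<in> lpa_relations E"
| range_ghost: "f \<in> arcs E \<Longrightarrow>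
    gen_word [Vertex (head E f), Ghost f] - gen_word [Ghost f] \<in> lpa_relations E"
| ghost_source: "f \<in> arcs E \<Longrightarrow>
    gen_word [Ghost f, Vertex (tail E f)] - gen_word [Ghost f] \<in> lpa_relations E"
| ghost_edge: "\<lbrakk>f \<in> arcs E; f' \<in> arcs E\<rbrakk> \<Longrightarrow>
    gen_word [Ghost f, Edge f'] - (if f = f' then gen_word [Vertex (head E f)] else 0) \<in> lpa_relations E"
| vertex_sum: "v \<in> regular_vertices E \<Longrightarrow>
    gen_word [Vertex v] - (\<Sum>f\<in>out_arcs E v. gen_word [Edge f, Ghost f]) \<in> lpa_relations E"

text \<open>
  The two-sided ideal generated by the relations, closed under scalars on both sides.
  Closure under scalars is not implied by the other rules, since the free algebra has no identity.
\<close>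

inductive_set lpa_ideal :: "('v, 'e) pre_digraph \<Rightarrow> ('v, 'e, 'r::ring_1) free_alg set"
  for E :: "('v, 'e) pre_digraph" where
  relation: "p \<in> lpa_relations E \<Longrightarrow> p \<in> lpa_ideal E"
| zero: "0 \<in> lpa_ideal E"
| add: "\<lbrakk>p \<in> lpa_ideal E; q \<in> lpa_ideal E\<rbrakk> \<Longrightarrow> p + q \<in> lpa_ideal E"
| scalar_left: "p \<in> lpa_ideal E \<Longrightarrow> lpa_scalar r * p \<in> lpa_ideal E"
| scalar_right: "p \<in> lpa_ideal E \<Longrightarrow> p * lpa_scalar r \<in> lpa_ideal E"
| mult_left: "\<lbrakk>p \<in> lpa_ideal E; a \<in> free_alg_carrier E\<rbrakk> \<Longrightarrow> a * p \<in> lpa_ideal E"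
| mult_right: "\<lbrakk>p \<in> lpa_ideal E; a \<in> free_alg_carrier E\<rbrakk> \<Longrightarrow> p * a \<in> lpa_ideal E"

text \<open>The elements are the cosets of \<^const>\<open>lpa_ideal\<close> in the free algebra.\<close>

definition leavitt_path_algebra ::
    "'r itself \<Rightarrow> ('v, 'e) pre_digraph \<Rightarrow> ('v, 'e, 'r::ring_1) free_alg set ring" where
  "leavitt_path_algebra _ E = free_alg_ring E Quot lpa_ideal E"

lemma nonunital_ring_free_alg:
  "nonunital_ring (free_alg_ring E :: ('v, 'e, 'r::ring_1) free_alg ring)"
proof -
  have add: "p + q \<in> free_alg_carrier E" if "p \<in> free_alg_carrier E" "q \<in> free_alg_carrier E"
    for p q :: "('v, 'e, 'r) free_alg"
    using that keys_add[of p q] unfolding free_alg_carrier_def by blast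
  have zero: "0 \<in> (free_alg_carrier E :: ('v, 'e, 'r) free_alg set)"
    by (simp add: free_alg_carrier_def)
  have minus: "- p \<in> free_alg_carrier E" if "p \<in> free_alg_carrier E"
    for p :: "('v, 'e, 'r) free_alg"
    using that by (simp add: free_alg_carrier_def)
  have mult: "p * q \<in> free_alg_carrier E" if "p \<in> free_alg_carrier E" "q \<in> free_alg_carrier E"
    for p q :: "('v, 'e, 'r) free_alg"
    using that keys_mult[of p q] unfolding free_alg_carrier_def
    by (fastforce simp: plus_word_def)
  have ag: "abelian_group (free_alg_ring E :: ('v, 'e, 'r) free_alg ring)"
    by (rule abelian_groupI)
      (auto simp: free_alg_ring_def add zero add.assoc add.commute intro: minus bexI[of _ "- _"])
  interpret abelian_group "free_alg_ring E :: ('v, 'e, 'r) free_alg ring" by (rule ag)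
  show ?thesis
    by unfold_locales (auto simp: free_alg_ring_def mult mult.assoc distrib_left distrib_right)
qed

lemma lpa_ideal_subset:
  assumes "wf_digraph E"
  shows "lpa_ideal E \<subseteq> (free_alg_carrier E :: ('v, 'e, 'r::ring_1) free_alg set)"
proof
  interpret wf_digraph E by fact
  interpret F: nonunital_ring "free_alg_ring E :: ('v, 'e, 'r) free_alg ring"
    by (rule nonunital_ring_free_alg)
  have word: "gen_word gs \<in> (free_alg_carrier E :: ('v, 'e, 'r) free_alg set)"
    if "gs \<noteq> []" "set gs \<subseteq> lpa_gens E" for gs
    using that by (simp add: free_alg_carrier_def gen_word_def)
  have diff: "p - q \<in> free_alg_carrier E" if "p \<in> free_alg_carrier E" "q \<in> free_alg_carrier E"
    for p q :: "('v, 'e, 'r) free_alg"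
    using that keys_diff[of p q] unfolding free_alg_carrier_def by blast
  have sum: "(\<Sum>f\<in>A. p f) \<in> free_alg_carrier E" if "\<And>f. f \<in> A \<Longrightarrow> p f \<in> free_alg_carrier E"
    for A :: "'e set" and p :: "'e \<Rightarrow> ('v, 'e, 'r) free_alg"
    using that keys_sum[of p A] unfolding free_alg_carrier_def by blast
  have rel: "p \<in> free_alg_carrier E" if "p \<in> lpa_relations E" for p :: "('v, 'e, 'r) free_alg"
    using that
    by cases
      (auto intro!: diff sum word F.zero_closed[unfolded free_alg_ring_def, simplified]
        simp: lpa_gens_def regular_vertices_def)
  fix p :: "('v, 'e, 'r) free_alg"
  assume "p \<in> lpa_ideal E"
  then show "p \<in> free_alg_carrier E"
  proof induction
    case (scalar_left p r)
    then show ?case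
      using keys_mult[of "lpa_scalar r" p] unfolding free_alg_carrier_def lpa_scalar_def
      by (fastforce split: if_splits)
  next
    case (scalar_right p r)
    then show ?case
      using keys_mult[of p "lpa_scalar r"] unfolding free_alg_carrier_def lpa_scalar_def
      by (fastforce split: if_splits)
  qed (use rel F.zero_closed F.a_closed F.rng_m_closed in \<open>auto simp: free_alg_ring_def\<close>)
qed

lemma nonunital_ring_leavitt_path_algebra:
  fixes E :: "('v, 'e) pre_digraph"
  assumes "wf_digraph E"
  shows "nonunital_ring (leavitt_path_algebra TYPE('r::ring_1) E)"
proof -
  interpret F: nonunital_ring "free_alg_ring E :: ('v, 'e, 'r) free_alg ring"
    by (rule nonunital_ring_free_alg)
  have sub: "lpa_ideal E \<subseteq> carrier (free_alg_ring E :: ('v, 'e, 'r) free_alg ring)"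
    using lpa_ideal_subset[OF assms] by (simp add: free_alg_ring_def)
  have neg: "\<ominus>\<^bsub>free_alg_ring E\<^esub> p \<in> lpa_ideal E" if p: "p \<in> lpa_ideal E"
    for p :: "('v, 'e, 'r) free_alg"
  proof -
    have "lpa_scalar (- 1) = (- 1 :: ('v, 'e, 'r) free_alg)"
      by (simp add: lpa_scalar_def single_uminus single_one)
    then have m: "- p \<in> lpa_ideal E" using lpa_ideal.scalar_left[OF p, of "- 1"] by simp
    have "\<ominus>\<^bsub>free_alg_ring E\<^esub> p = - p"
      by (rule F.minus_equality) (use m p sub in \<open>auto simp: free_alg_ring_def\<close>)
    with m show ?thesis by simp
  qed
  have ne: "lpa_ideal E \<noteq> ({} :: ('v, 'e, 'r) free_alg set)"
    using lpa_ideal.zero by blast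
  have "additive_subgroup (lpa_ideal E) (free_alg_ring E :: ('v, 'e, 'r) free_alg ring)"
    by (intro additive_subgroup.intro F.add.subgroupI)
      (use sub neg ne in \<open>auto simp: free_alg_ring_def a_inv_def intro: lpa_ideal.add\<close>)
  then show ?thesis unfolding leavitt_path_algebra_def
    by (rule F.nonunital_ring_Quot)
      (auto simp: free_alg_ring_def intro: lpa_ideal.mult_left lpa_ideal.mult_right)
qed

end

theory Submission
  imports Defs
begin

text \<open>
  Give the Leavitt path algebra its grading by the integers, in which an edge has degree \<open>1\<close> and a ghost
  edge degree \<open>-1\<close>. Every homogeneous element \<open>x\<close> satisfies \<open>x = x y x\<close> for some \<open>y\<close>: the elements
  \<open>\<alpha> v \<beta>\<^sup>*\<close> with \<open>\<alpha>\<close> and \<open>\<beta>\<close> of fixed lengths multiply like matrix units over the regular ring \<open>R\<close>, the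
  span of the longest ones absorbs the shorter ones, and \<open>x\<close> is regular as soon as \<open>x - x y x\<close> is.

  Semiprimeness follows by comparing components of highest degree. For semiprimitivity, take an
  element of the radical outside \<open>0\<close> whose support spans as few degrees as possible. Multiplying by a
  generalized inverse of its top component and cutting down gives an element \<open>c\<close> of a corner
  \<open>e S e\<close>, with top component \<open>e\<close> in degree \<open>0\<close>. Commutators of \<open>c\<close> with homogeneous elements
  of the corner span fewer degrees, hence vanish, so \<open>c\<close> is central there. If \<open>c = e\<close>, the radical
  contains a nonzero idempotent, which is impossible. Otherwise the bottom component \<open>z\<close> of \<open>c\<close> is central
  of negative degree and invertible in a smaller corner, and for degree reasons \<open>c z\<close> has no
  quasi-inverse.
\<close>

section \<open>The Jacobson radical of a ring without identity\<close>

context nonunital_ring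
begin

lemma rng_r_null [simp]: "x \<in> carrier S \<Longrightarrow> x \<otimes> \<zero> = \<zero>"
  using rng_r_distr[of \<zero> \<zero> x] rng_m_closed[of x \<zero>] by (simp add: add.l_cancel_one')

lemma rng_l_null [simp]: "x \<in> carrier S \<Longrightarrow> \<zero> \<otimes> x = \<zero>"
  using rng_l_distr[of \<zero> \<zero> x] rng_m_closed[of \<zero> x] by (simp add: add.l_cancel_one')

lemma rng_r_minus: "\<lbrakk>x \<in> carrier S; y \<in> carrier S\<rbrakk> \<Longrightarrow> x \<otimes> (\<ominus> y) = \<ominus> (x \<otimes> y)"
  using rng_r_distr[of "\<ominus> y" y x] by (intro minus_equality[symmetric]) (auto simp: l_neg rng_m_closed)

lemma rng_l_minus: "\<lbrakk>x \<in> carrier S; y \<in> carrier S\<rbrakk> \<Longrightarrow> (\<ominus> x) \<otimes> y = \<ominus> (x \<otimes> y)"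
  using rng_l_distr[of "\<ominus> x" x y] by (intro minus_equality[symmetric]) (auto simp: l_neg rng_m_closed)

lemma neg_zero: "\<ominus> \<zero> = \<zero>"
  by (rule minus_equality) simp_all

lemma is_left_ideal_iff:
  "is_left_ideal S M \<longleftrightarrow> M \<subseteq> carrier S \<and> \<zero> \<in> M \<and> (\<forall>x\<in>M. \<forall>y\<in>M. x \<oplus> y \<in> M) \<and>
     (\<forall>x\<in>M. \<ominus> x \<in> M) \<and> (\<forall>a\<in>carrier S. \<forall>x\<in>M. a \<otimes> x \<in> M)" (is "_ \<longleftrightarrow> ?R")
proof
  assume "is_left_ideal S M"
  then interpret M: additive_subgroup M S by (simp add: is_left_ideal_def)
  show ?R using M.a_subset M.a_closed M.zero_closed M.a_inv_closed \<open>is_left_ideal S M\<close>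
    by (auto simp: is_left_ideal_def)
next
  assume R: ?R
  have "subgroup M (add_monoid S)"
    by (rule add.subgroupI) (use R in \<open>auto simp: a_inv_def\<close>)
  with R show "is_left_ideal S M"
    by (simp add: is_left_ideal_def additive_subgroup.intro)
qed

section \<open>Radical elements have left quasi-inverses\<close>

lemma left_ideal_Union_chain:
  assumes "\<C> \<noteq> {}" "\<And>M. M \<in> \<C> \<Longrightarrow> is_left_ideal S M"
    and "\<And>M N. M \<in> \<C> \<Longrightarrow> N \<in> \<C> \<Longrightarrow> M \<subseteq> N \<or> N \<subseteq> M"
  shows "is_left_ideal S (\<Union>\<C>)"
  unfolding is_left_ideal_iff
proof (intro conjI ballI)
  fix x y assume "x \<in> \<Union>\<C>" "y \<in> \<Union>\<C>"
  then obtain M N where MN: "M \<in> \<C>" "N \<in> \<C>" "x \<in> M" "y \<in> N" by blast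
  with assms(3)[of M N] obtain K where "K \<in> \<C>" "x \<in> K" "y \<in> K" by blast
  with assms(2) show "x \<oplus> y \<in> \<Union>\<C>" unfolding is_left_ideal_iff by blast
qed (use assms(1) assms(2)[unfolded is_left_ideal_iff] in \<open>blast+\<close>)

text \<open>If \<open>a\<close> is not of the form \<open>u - u a\<close>, a left ideal containing
  every \<open>x - x a\<close> and maximal with respect to missing \<open>a\<close> is a modular
  maximal left ideal; it would have to contain \<open>a\<close>.\<close>

lemma jacobson_left_quasi_regular:
  assumes a: "a \<in> jacobson_radical S"
  shows "\<exists>u\<in>carrier S. a = u \<ominus> u \<otimes> a"
proof (rule ccontr)
  assume neg: "\<not> ?thesis"
  have aS: "a \<in> carrier S" using a by (simp add: jacobson_radical_def)
  define M0 where "M0 = (\<lambda>x. x \<ominus> x \<otimes> a) ` carrier S"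
  have M0: "is_left_ideal S M0"
    unfolding is_left_ideal_iff
  proof (intro conjI ballI)
    show "M0 \<subseteq> carrier S" using aS by (auto simp: M0_def rng_m_closed)
    show "\<zero> \<in> M0" unfolding M0_def
      by (rule image_eqI[of _ _ \<zero>]) (use aS in \<open>simp_all add: a_minus_def neg_zero\<close>)
  next
    fix x y assume "x \<in> M0" "y \<in> M0"
    then obtain s t where st: "s \<in> carrier S" "t \<in> carrier S" "x = s \<ominus> s \<otimes> a" "y = t \<ominus> t \<otimes> a"
      by (auto simp: M0_def)
    then have "x \<oplus> y = (s \<oplus> t) \<ominus> (s \<oplus> t) \<otimes> a"
      using aS by (simp add: a_minus_def rng_l_distr rng_m_closed minus_add a_ac)
    then show "x \<oplus> y \<in> M0" using st by (auto simp: M0_def)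
  next
    fix x assume "x \<in> M0"
    then obtain s where s: "s \<in> carrier S" "x = s \<ominus> s \<otimes> a" by (auto simp: M0_def)
    then have "\<ominus> x = (\<ominus> s) \<ominus> (\<ominus> s) \<otimes> a"
      using aS by (simp add: a_minus_def rng_l_minus rng_m_closed minus_add)
    then show "\<ominus> x \<in> M0" using s by (auto simp: M0_def)
  next
    fix b x assume b: "b \<in> carrier S" "x \<in> M0"
    then obtain s where s: "s \<in> carrier S" "x = s \<ominus> s \<otimes> a" by (auto simp: M0_def)
    then have "b \<otimes> x = (b \<otimes> s) \<ominus> (b \<otimes> s) \<otimes> a"
      using aS b by (simp add: a_minus_def rng_r_minus rng_r_distr rng_m_closed rng_m_assoc)
    then show "b \<otimes> x \<in> M0" using s b by (auto simp: M0_def rng_m_closed)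
  qed
  have aM0: "a \<notin> M0" using neg by (auto simp: M0_def)
  \<comment> \<open>Over \<open>M0\<close>, missing \<open>a\<close> is the same as being proper,
    because \<open>x = (x - x a) + x a\<close>.\<close>
  define \<A> where "\<A> = {N. is_left_ideal S N \<and> M0 \<subseteq> N \<and> a \<notin> N}"
  have "\<exists>M\<in>\<A>. \<forall>X\<in>\<A>. M \<subseteq> X \<longrightarrow> X = M"
  proof (rule subset_Zorn_nonempty)
    show "\<A> \<noteq> {}" using M0 aM0 by (auto simp: \<A>_def)
    fix \<C> assume C: "\<C> \<noteq> {}" "subset.chain \<A> \<C>"
    have "is_left_ideal S (\<Union>\<C>)"
      by (rule left_ideal_Union_chain) (use C in \<open>auto simp: subset_chain_def \<A>_def\<close>)
    then show "\<Union>\<C> \<in> \<A>" using C by (auto simp: subset_chain_def \<A>_def)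
  qed
  then obtain M where M: "is_left_ideal S M" "M0 \<subseteq> M" "a \<notin> M"
    and max: "\<And>X. is_left_ideal S X \<Longrightarrow> M0 \<subseteq> X \<Longrightarrow> a \<notin> X \<Longrightarrow> M \<subseteq> X \<Longrightarrow> X = M"
    by (auto simp: \<A>_def)
  have full: "N = carrier S" if N: "is_left_ideal S N" "M \<subseteq> N" "a \<in> N" for N
  proof
    show "N \<subseteq> carrier S" using N by (simp add: is_left_ideal_iff)
    show "carrier S \<subseteq> N"
    proof
      fix x assume x: "x \<in> carrier S"
      have "x \<ominus> x \<otimes> a \<in> N" "x \<otimes> a \<in> N"
        using N M x by (auto simp: M0_def is_left_ideal_iff)
      moreover have "x = (x \<ominus> x \<otimes> a) \<oplus> x \<otimes> a"
        using x aS by (simp add: a_minus_def rng_m_closed a_assoc l_neg)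
      ultimately show "x \<in> N" using N by (metis is_left_ideal_iff)
    qed
  qed
  have "is_maximal_left_ideal S M"
    unfolding is_maximal_left_ideal_def using M max full aS by blast
  moreover have "is_modular_left_ideal S M"
    unfolding is_modular_left_ideal_def using M aS by (auto simp: M0_def)
  ultimately show False using a M by (auto simp: jacobson_radical_def)
qed

section \<open>The radical is a two-sided ideal\<close>

lemma jacobson_left_ideal: "is_left_ideal S (jacobson_radical S)"
  unfolding is_left_ideal_iff
  by (auto simp: jacobson_radical_def is_maximal_left_ideal_def is_left_ideal_iff rng_m_closed)

text \<open>
  If \<open>s\<close> is not in the maximal modular left ideal \<open>M\<close>, then the ideal quotient \<open>{x. x \<otimes> s \<in> M}\<close>
  is again a maximal modular left ideal.
\<close>

lemma jacobson_mult_right: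
  assumes a: "a \<in> jacobson_radical S" and s: "s \<in> carrier S"
  shows "a \<otimes> s \<in> jacobson_radical S"
proof -
  have aS: "a \<in> carrier S" using a by (simp add: jacobson_radical_def)
  have "a \<otimes> s \<in> M" if M: "is_maximal_left_ideal S M" "is_modular_left_ideal S M" for M
  proof (rule ccontr)
    assume neg: "a \<otimes> s \<notin> M"
    have Mid: "is_left_ideal S M" using M by (simp add: is_maximal_left_ideal_def)
    note Mid' = Mid[unfolded is_left_ideal_iff]
    have McS: "\<And>m. m \<in> M \<Longrightarrow> m \<in> carrier S" using Mid' by auto
    \<comment> \<open>The left ideal \<open>N s + M\<close> contains \<open>M\<close>, so by
      maximality it is the whole ring as soon as \<open>N s\<close> is not inside
      \<open>M\<close>.\<close>
    have sum_ideal: "is_left_ideal S {x \<otimes> s \<oplus> m |x m. x \<in> N \<and> m \<in> M}"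
      if N: "is_left_ideal S N" for N
    proof -
      note N' = N[unfolded is_left_ideal_iff]
      have Nc: "\<And>m. m \<in> N \<Longrightarrow> m \<in> carrier S" using N' by auto
      show ?thesis unfolding is_left_ideal_iff
      proof (intro conjI ballI)
        show "{x \<otimes> s \<oplus> m |x m. x \<in> N \<and> m \<in> M} \<subseteq> carrier S"
          using Nc McS s by (auto simp: rng_m_closed)
        show "\<zero> \<in> {x \<otimes> s \<oplus> m |x m. x \<in> N \<and> m \<in> M}"
          using N' Mid' s by (auto intro!: exI[of _ \<zero>])
      next
        fix x y assume "x \<in> {x \<otimes> s \<oplus> m |x m. x \<in> N \<and> m \<in> M}" "y \<in> {x \<otimes> s \<oplus> m |x m. x \<in> N \<and> m \<in> M}"
        then obtain p m q n where pq: "p \<in> N" "m \<in> M" "q \<in> N" "n \<in> M"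
          "x = p \<otimes> s \<oplus> m" "y = q \<otimes> s \<oplus> n" by blast
        then have "x \<oplus> y = (p \<oplus> q) \<otimes> s \<oplus> (m \<oplus> n)"
          using Nc McS s by (simp add: rng_l_distr rng_m_closed a_ac)
        then show "x \<oplus> y \<in> {x \<otimes> s \<oplus> m |x m. x \<in> N \<and> m \<in> M}"
          using pq N' Mid' by blast
      next
        fix x assume "x \<in> {x \<otimes> s \<oplus> m |x m. x \<in> N \<and> m \<in> M}"
        then obtain p m where pq: "p \<in> N" "m \<in> M" "x = p \<otimes> s \<oplus> m" by blast
        then have "\<ominus> x = (\<ominus> p) \<otimes> s \<oplus> (\<ominus> m)"
          using Nc McS s by (simp add: rng_l_minus rng_m_closed minus_add)
        then show "\<ominus> x \<in> {x \<otimes> s \<oplus> m |x m. x \<in> N \<and> m \<in> M}"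
          using pq N' Mid' by blast
      next
        fix b x assume b: "b \<in> carrier S" and "x \<in> {x \<otimes> s \<oplus> m |x m. x \<in> N \<and> m \<in> M}"
        then obtain p m where pq: "p \<in> N" "m \<in> M" "x = p \<otimes> s \<oplus> m" by blast
        then have "b \<otimes> x = (b \<otimes> p) \<otimes> s \<oplus> b \<otimes> m"
          using Nc McS s b by (simp add: rng_r_distr rng_m_closed rng_m_assoc)
        then show "b \<otimes> x \<in> {x \<otimes> s \<oplus> m |x m. x \<in> N \<and> m \<in> M}"
          using pq N' Mid' b by blast
      qed
    qed
    have sum_full: "\<exists>x\<in>N. \<exists>m\<in>M. t = x \<otimes> s \<oplus> m"
      if N: "is_left_ideal S N" and n: "n \<in> N" "n \<otimes> s \<notin> M" and t: "t \<in> carrier S" for N n t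
    proof -
      have Nc: "n \<in> carrier S" "\<zero> \<in> N" using N n by (auto simp: is_left_ideal_iff)
      let ?K = "{x \<otimes> s \<oplus> m |x m. x \<in> N \<and> m \<in> M}"
      have "m \<in> ?K" if "m \<in> M" for m
        using that Nc McS s by (intro CollectI exI[of _ \<zero>] exI[of _ m]) simp
      moreover have "n \<otimes> s \<in> ?K"
        using n Nc s Mid' by (intro CollectI exI[of _ n] exI[of _ \<zero>]) (simp add: rng_m_closed)
      ultimately have "?K = carrier S"
        using M sum_ideal[OF N] n unfolding is_maximal_left_ideal_def by blast
      with t show ?thesis by blast
    qed
    define N where "N = {x \<in> carrier S. x \<otimes> s \<in> M}"
    have N: "is_left_ideal S N"
      unfolding is_left_ideal_iff N_def
      using Mid' s by (auto simp: rng_l_distr rng_l_minus rng_m_closed rng_m_assoc)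
    have carr: "is_left_ideal S (carrier S)" by (auto simp: is_left_ideal_iff rng_m_closed)
    have maximal: "K = carrier S" if K: "is_left_ideal S K" "N \<subseteq> K" "K \<noteq> N" for K
    proof -
      note K' = K(1)[unfolded is_left_ideal_iff]
      obtain n where n: "n \<in> K" "n \<notin> N" using K by blast
      then have ns: "n \<otimes> s \<notin> M" using K' by (auto simp: N_def)
      have "x \<in> K" if x: "x \<in> carrier S" for x
      proof -
        \<comment> \<open>Writing \<open>x s = k s + m\<close> puts \<open>x - k\<close> into
          \<open>N\<close>, hence into \<open>K\<close>.\<close>
        obtain k m where km: "k \<in> K" "m \<in> M" "x \<otimes> s = k \<otimes> s \<oplus> m"
          using sum_full[OF K(1) n(1) ns rng_m_closed[OF x s]] by blast
        have kS: "k \<in> carrier S" using km K' by auto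
        have "(x \<ominus> k) \<otimes> s = m"
          using km kS x s McS
          by (simp add: a_minus_def rng_l_distr rng_l_minus rng_m_closed r_neg a_ac)
        then have "x \<ominus> k \<in> N" using km kS x by (simp add: N_def)
        then have "(x \<ominus> k) \<oplus> k \<in> K" using K K' km by blast
        moreover have "(x \<ominus> k) \<oplus> k = x" using x kS by (simp add: a_minus_def a_assoc l_neg)
        ultimately show ?thesis by simp
      qed
      then show ?thesis using K' by blast
    qed
    \<comment> \<open>Since \<open>a s\<close> is outside \<open>M\<close>, the decomposition with
      the whole ring in place of \<open>N\<close> gives \<open>s = e s + m\<close>. Then
      \<open>(x - x e) s = x (s - e s)\<close> lies in \<open>M\<close>, so \<open>e\<close> is a
      right identity modulo the ideal quotient.\<close>
    obtain e m where e: "e \<in> carrier S" "m \<in> M" "s = e \<otimes> s \<oplus> m"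
      using sum_full[OF carr aS neg s] by blast
    have "x \<ominus> x \<otimes> e \<in> N" if x: "x \<in> carrier S" for x
    proof -
      have "s \<ominus> e \<otimes> s = m"
        using e s McS
        by (metis a_comm add.inv_solve_right' a_minus_def rng_m_closed)
      then have "x \<otimes> (s \<ominus> e \<otimes> s) \<in> M" using Mid' x e by simp
      moreover have "x \<otimes> (s \<ominus> e \<otimes> s) = (x \<ominus> x \<otimes> e) \<otimes> s"
        using x e(1) s
        by (simp add: a_minus_def rng_l_distr rng_r_distr rng_l_minus rng_r_minus rng_m_closed rng_m_assoc)
      ultimately show ?thesis using x e by (simp add: N_def rng_m_closed)
    qed
    then have "is_modular_left_ideal S N" using N e by (auto simp: is_modular_left_ideal_def)
    moreover have "is_maximal_left_ideal S N"
      using N maximal neg aS by (auto simp: is_maximal_left_ideal_def N_def)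
    ultimately have "a \<in> N" using a by (auto simp: jacobson_radical_def)
    with neg show False by (simp add: N_def)
  qed
  then show ?thesis using aS s by (simp add: jacobson_radical_def rng_m_closed)
qed

end

section \<open>Graded rings whose homogeneous elements are regular\<close>

text \<open>Calculations in the quotient of \<open>C\<close> by \<open>I\<close> are done with
  representatives in an ambient ring. A subset \<open>C\<close> is used so that one ambient ring
  serves both the algebra without identity and its enlargement by scalars.\<close>

locale ideal_mod =
  fixes C I :: "'a::ring set"
  assumes C_0: "0 \<in> C" and C_add: "\<lbrakk>x \<in> C; y \<in> C\<rbrakk> \<Longrightarrow> x + y \<in> C"
    and C_uminus: "x \<in> C \<Longrightarrow> - x \<in> C" and C_mult: "\<lbrakk>x \<in> C; y \<in> C\<rbrakk> \<Longrightarrow> x * y \<in> C"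
    and I_0: "0 \<in> I" and I_add: "\<lbrakk>x \<in> I; y \<in> I\<rbrakk> \<Longrightarrow> x + y \<in> I"
    and I_uminus: "x \<in> I \<Longrightarrow> - x \<in> I"
    and I_mult_left: "\<lbrakk>a \<in> C; x \<in> I\<rbrakk> \<Longrightarrow> a * x \<in> I"
    and I_mult_right: "\<lbrakk>x \<in> I; a \<in> C\<rbrakk> \<Longrightarrow> x * a \<in> I"
    and I_sub: "I \<subseteq> C"
begin

definition cg (infix "\<approx>" 50) where "x \<approx> y \<longleftrightarrow> x - y \<in> I"

lemma C_diff: "\<lbrakk>x \<in> C; y \<in> C\<rbrakk> \<Longrightarrow> x - y \<in> C"
  using C_add[of x "- y"] C_uminus[of y] by simp

lemma I_diff: "\<lbrakk>x \<in> I; y \<in> I\<rbrakk> \<Longrightarrow> x - y \<in> I"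
  using I_add[of x "- y"] I_uminus[of y] by simp

lemma cg_refl [simp]: "x \<approx> x"
  by (simp add: cg_def I_0)

lemma cg_sym: "x \<approx> y \<Longrightarrow> y \<approx> x"
  unfolding cg_def using I_uminus[of "x - y"] by simp

lemma cg_trans [trans]: "\<lbrakk>x \<approx> y; y \<approx> z\<rbrakk> \<Longrightarrow> x \<approx> z"
  unfolding cg_def using I_add[of "x - y" "y - z"] by simp

lemma cg_add: "\<lbrakk>x \<approx> x'; y \<approx> y'\<rbrakk> \<Longrightarrow> x + y \<approx> x' + y'"
  unfolding cg_def using I_add[of "x - x'" "y - y'"] by (simp add: algebra_simps)

lemma cg_diff: "\<lbrakk>x \<approx> x'; y \<approx> y'\<rbrakk> \<Longrightarrow> x - y \<approx> x' - y'"
  unfolding cg_def using I_diff[of "x - x'" "y - y'"] by (simp add: algebra_simps)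

lemma cg_left: "\<lbrakk>x \<approx> y; a \<in> C\<rbrakk> \<Longrightarrow> a * x \<approx> a * y"
  unfolding cg_def using I_mult_left[of a "x - y"] by (simp add: algebra_simps)

lemma cg_right: "\<lbrakk>x \<approx> y; a \<in> C\<rbrakk> \<Longrightarrow> x * a \<approx> y * a"
  unfolding cg_def using I_mult_right[of "x - y" a] by (simp add: algebra_simps)

lemma cg_I: "x \<approx> y \<Longrightarrow> x \<in> I \<longleftrightarrow> y \<in> I"
  unfolding cg_def using I_add[of "x - y" y] I_diff[of x "x - y"] by auto

lemma I_sum: "(\<And>j. j \<in> A \<Longrightarrow> f j \<in> I) \<Longrightarrow> sum f A \<in> I"
  by (induction A rule: infinite_finite_induct) (auto intro: I_0 I_add)

end

text \<open>\<open>h n\<close> is the projection to degree \<open>n\<close>. It grades the whole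
  ambient ring and preserves \<open>C\<close> and \<open>I\<close>, so degree equations hold
  exactly; only regularity is taken modulo \<open>I\<close>.\<close>

locale graded_mod = ideal_mod C I for C I :: "'a::ring set" +
  fixes h :: "int \<Rightarrow> 'a \<Rightarrow> 'a"
  assumes h_add: "h n (x + y) = h n x + h n y"
    and h_C: "x \<in> C \<Longrightarrow> h n x \<in> C"
    and h_I: "x \<in> I \<Longrightarrow> h n x \<in> I"
    and h_h: "h m (h n x) = (if m = n then h n x else 0)"
    and h_finite: "finite {n. h n x \<noteq> 0}"
    and h_sum: "(\<Sum>n | h n x \<noteq> 0. h n x) = x"
    and h_mult_left: "h n (h m x * y) = h m x * h (n - m) y"
    and h_mult_right: "h n (x * h m y) = h (n - m) x * h m y"
    and homogeneous_regular: "x \<in> C \<Longrightarrow> \<exists>y\<in>C. h n x * y * h n x - h n x \<in> I"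
begin

lemma h_0 [simp]: "h n 0 = 0"
  using h_add[of n 0 0] by simp

lemma h_uminus: "h n (- x) = - h n x"
  using h_add[of n x "- x"] by (simp add: add_eq_0_iff2)

lemma h_diff: "h n (x - y) = h n x - h n y"
  using h_add[of n x "- y"] by (simp add: h_uminus)

lemma h_sum_distrib: "h n (sum f A) = (\<Sum>j\<in>A. h n (f j))"
  by (induction A rule: infinite_finite_induct) (auto simp: h_add)

lemma h_cg: "x \<approx> y \<Longrightarrow> h n x \<approx> h n y"
  using h_I[of "x - y" n] by (simp add: h_diff cg_def)

text \<open>An element is the finite sum of its components and \<open>I\<close> is preserved by the
  projections, so membership can be tested degree by degree.\<close>

lemma I_iff: "x \<in> I \<longleftrightarrow> (\<forall>n. h n x \<in> I)"
  using h_I h_sum[of x] I_sum[of "{n. h n x \<noteq> 0}" "\<lambda>n. h n x"] by auto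

lemma cg_single_component:
  assumes "\<And>i. i \<noteq> n \<Longrightarrow> h i x \<in> I"
  shows "x \<approx> h n x"
  unfolding cg_def I_iff[of "x - h n x"] using assms by (auto simp: h_diff h_h I_0)

text \<open>In the convolution sum for the degree \<open>i\<close> component, each summand other
  than the one at \<open>m\<close> has a factor in \<open>I\<close>. With top or bottom degrees this
  isolates the product of extreme components.\<close>

lemma h_mult_cg:
  assumes C: "x \<in> C" "y \<in> C"
    and zero: "\<And>j. j \<noteq> m \<Longrightarrow> h j x \<in> I \<or> h (i - j) y \<in> I"
  shows "h i (x * y) \<approx> h m x * h (i - m) y"
proof -
  let ?A = "{n. h n x \<noteq> 0}"
  have "x * y = (\<Sum>j\<in>?A. h j x * y)"
    by (subst h_sum[of x, symmetric]) (simp add: sum_distrib_right)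
  then have "h i (x * y) = (\<Sum>j\<in>?A. h j x * h (i - j) y)"
    by (simp add: h_sum_distrib h_mult_left)
  \<comment> \<open>\<open>m\<close> may lie outside the support of \<open>x\<close>; the summand
    added for it is then zero.\<close>
  also have "\<dots> = (\<Sum>j\<in>insert m ?A. h j x * h (i - j) y)"
    by (rule sum.mono_neutral_left) (auto simp: h_finite)
  also have "\<dots> = h m x * h (i - m) y + (\<Sum>j\<in>?A - {m}. h j x * h (i - j) y)"
    by (subst sum.insert_remove) (auto simp: h_finite)
  finally have "h i (x * y) - h m x * h (i - m) y = (\<Sum>j\<in>?A - {m}. h j x * h (i - j) y)"
    by simp
  also have "\<dots> \<in> I"
  proof (rule I_sum)
    fix j assume "j \<in> ?A - {m}"
    then show "h j x * h (i - j) y \<in> I"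
      using zero[of j] C by (auto intro: I_mult_left I_mult_right h_C)
  qed
  finally show ?thesis unfolding cg_def .
qed

lemma h_mult_I:
  assumes "x \<in> C" "y \<in> C" "\<And>j. h j x \<in> I \<or> h (i - j) y \<in> I"
  shows "h i (x * y) \<in> I"
proof -
  \<comment> \<open>The index 0 is an arbitrary choice, since every summand lies in
    \<open>I\<close>.\<close>
  have "h i (x * y) \<approx> h 0 x * h (i - 0) y" by (rule h_mult_cg) (use assms in auto)
  moreover have "h 0 x * h (i - 0) y \<in> I"
    using assms(1,2) assms(3)[of 0] by (auto intro: I_mult_left I_mult_right h_C)
  ultimately show ?thesis using cg_I by blast
qed

text \<open>Comparing degree \<open>n\<close> components of
  \<open>h n x * y * h n x \<approx> h n x\<close> retains only the degree \<open>-n\<close> part of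
  \<open>y\<close>.\<close>

lemma homogeneous_regular':
  assumes "x \<in> C"
  shows "\<exists>y\<in>C. h (- n) y = y \<and> h n x * y * h n x \<approx> h n x"
proof -
  obtain y where y: "y \<in> C" "h n x * y * h n x \<approx> h n x"
    using homogeneous_regular[OF assms, of n] unfolding cg_def by blast
  have "h n x * h (- n) y * h n x \<approx> h n x"
    using h_cg[OF y(2), of n] h_mult_right[of n "h n x * y" n x] h_mult_left[of "n - n" n x y]
    by (simp add: h_h)
  then show ?thesis using y by (intro bexI[of _ "h (- n) y"]) (auto simp: h_h h_C)
qed

lemma obtain_top_component:
  assumes "x \<notin> I"
  obtains n where "h n x \<notin> I" "\<And>i. i > n \<Longrightarrow> h i x \<in> I"
proof -
  let ?A = "{n. h n x \<notin> I}"
  have fin: "finite ?A" by (rule finite_subset[OF _ h_finite[of x]]) (auto simp: I_0)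
  moreover have "?A \<noteq> {}" using assms I_iff[of x] by blast
  ultimately have "Max ?A \<in> ?A" by (rule Max_in)
  then have "h (Max ?A) x \<notin> I" by simp
  moreover have "h i x \<in> I" if "i > Max ?A" for i
    using Max_ge[OF fin, of i] that by fastforce
  ultimately show ?thesis by (rule that)
qed

lemma obtain_bottom_component:
  assumes "x \<notin> I"
  obtains n where "h n x \<notin> I" "\<And>i. i < n \<Longrightarrow> h i x \<in> I"
proof -
  let ?A = "{n. h n x \<notin> I}"
  have fin: "finite ?A" by (rule finite_subset[OF _ h_finite[of x]]) (auto simp: I_0)
  moreover have "?A \<noteq> {}" using assms I_iff[of x] by blast
  ultimately have "Min ?A \<in> ?A" by (rule Min_in)
  then have "h (Min ?A) x \<notin> I" by simp
  moreover have "h i x \<in> I" if "i < Min ?A" for i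
    using Min_le[OF fin, of i] that by fastforce
  ultimately show ?thesis by (rule that)
qed

section \<open>Semiprimeness by comparing highest components\<close>

lemma graded_semiprime:
  assumes a: "a \<in> C" and zero: "\<And>x. x \<in> C \<Longrightarrow> a * x * a \<in> I"
  shows "a \<in> I"
proof (rule ccontr)
  assume "a \<notin> I"
  then obtain n where n: "h n a \<notin> I" "\<And>i. i > n \<Longrightarrow> h i a \<in> I"
    by (rule obtain_top_component) blast
  obtain b where b: "b \<in> C" "h (- n) b = b" "h n a * b * h n a \<approx> h n a"
    using homogeneous_regular'[OF a, of n] by blast
  have ab: "h j (a * b) = h (j + n) a * b" for j
    using h_mult_right[of j a "- n" b] b by simp
  have "h n (a * b * a) \<approx> h 0 (a * b) * h (n - 0) a"
  proof (rule h_mult_cg)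
    \<comment> \<open>Multiplication by \<open>b\<close> moves the top degree of \<open>a\<close>
      from \<open>n\<close> to 0: for positive \<open>j\<close> the left factor lies in
      \<open>I\<close>, for negative \<open>j\<close> the right one.\<close>
    fix j :: int assume "j \<noteq> 0"
    then show "h j (a * b) \<in> I \<or> h (n - j) a \<in> I"
      using n(2)[of "j + n"] n(2)[of "n - j"] b(1) unfolding ab
      by (cases "j > 0") (auto intro: I_mult_right)
  qed (use a b in \<open>auto intro: C_mult\<close>)
  also have "\<dots> = h n a * b * h n a" by (simp add: ab)
  also note b(3)
  finally show False using n(1) h_I[OF zero[OF b(1)], of n] cg_I by blast
qed

section \<open>Quasi-regular ideals are trivial, by descent on the width of the support\<close>

definition window :: "int \<Rightarrow> nat \<Rightarrow> 'a \<Rightarrow> bool" where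
  "window n k x \<longleftrightarrow> (\<forall>i. h i x \<notin> I \<longrightarrow> n - int k \<le> i \<and> i \<le> n)"

text \<open>In the application \<open>J\<close> is the preimage of the radical; the argument rests
  on its being a two-sided ideal of elements with left quasi-inverses modulo \<open>I\<close>. The
  width \<open>k\<close> of a \<open>window\<close> is the quantity minimized.\<close>

lemma graded_quasi_regular_ideal_trivial:
  assumes J: "I \<subseteq> J" "J \<subseteq> C"
    and J_diff: "\<And>x y. x \<in> J \<Longrightarrow> y \<in> J \<Longrightarrow> x - y \<in> J"
    and J_left: "\<And>a x. a \<in> C \<Longrightarrow> x \<in> J \<Longrightarrow> a * x \<in> J"
    and J_right: "\<And>a x. a \<in> C \<Longrightarrow> x \<in> J \<Longrightarrow> x * a \<in> J"
    and quasi_regular: "\<And>x. x \<in> J \<Longrightarrow> \<exists>u\<in>C. x \<approx> u - u * x"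
  shows "J \<subseteq> I"
proof (rule ccontr)
  assume "\<not> J \<subseteq> I"
  then obtain a0 where a0: "a0 \<in> J" "a0 \<notin> I" by blast
  have "\<exists>k n. window n k a0"
  proof -
    obtain t where t: "h t a0 \<notin> I" "\<And>i. i > t \<Longrightarrow> h i a0 \<in> I"
      using obtain_top_component[OF a0(2)] by blast
    obtain b where b: "\<And>i. i < b \<Longrightarrow> h i a0 \<in> I"
      using obtain_bottom_component[OF a0(2)] by blast
    have "window t (nat (t - b)) a0"
      unfolding window_def using t b by (smt (verit) nat_0_le)
    then show ?thesis by blast
  qed
  with a0 have ex: "\<exists>k n a. a \<in> J \<and> a \<notin> I \<and> window n k a" by metis
  define k where "k = (LEAST k. \<exists>n a. a \<in> J \<and> a \<notin> I \<and> window n k a)"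
  obtain n a where a: "a \<in> J" "a \<notin> I" "window n k a"
    using LeastI_ex[OF ex] unfolding k_def by blast
  have min: "x \<in> I" if "x \<in> J" "window i l x" "l < k" for x i l
    using that not_less_Least[of l "\<lambda>k. \<exists>n a. a \<in> J \<and> a \<notin> I \<and> window n k a"]
    unfolding k_def by blast
  have JC: "x \<in> C" if "x \<in> J" for x using that J by blast
  have aC: "a \<in> C" using a JC by blast
  \<comment> \<open>Multiplying \<open>p \<approx> u - u * p\<close> by \<open>p\<close> on the
    right gives \<open>p \<approx> u * p - u * p\<close>.\<close>
  have idem: "p \<in> I" if p: "p \<in> J" "p * p \<approx> p" for p
  proof -
    obtain u where u: "u \<in> C" "p \<approx> u - u * p" using quasi_regular[OF p(1)] by blast
    have pC: "p \<in> C" using p JC by blast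
    have "p \<approx> p * p" using p cg_sym by blast
    also have "p * p \<approx> (u - u * p) * p" using u pC cg_right by blast
    also have "(u - u * p) * p = u * p - u * (p * p)" by (simp add: algebra_simps)
    also have "\<dots> \<approx> u * p - u * p" by (intro cg_diff cg_left cg_refl p u)
    finally show ?thesis by (simp add: cg_def)
  qed
  \<comment> \<open>Otherwise the window could lose its top degree, against the choice of
    \<open>k\<close>; for \<open>k = 0\<close> nothing would remain of \<open>a\<close>.\<close>
  have top: "h n a \<notin> I"
  proof
    assume hI: "h n a \<in> I"
    show False
    proof (cases k)
      case 0
      then have "a \<approx> h n a" using a(3) by (intro cg_single_component) (auto simp: window_def)
      then show ?thesis using hI a cg_I by blast
    next
      case (Suc l)
      have "window (n - 1) l a"
        using a(3) hI unfolding window_def Suc by (smt (verit) of_nat_Suc)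
      then show ?thesis using min[of a] a Suc by blast
    qed
  qed
  obtain b where b: "b \<in> C" "h (- n) b = b" "h n a * b * h n a \<approx> h n a"
    using homogeneous_regular'[OF aC, of n] by blast
  define e where "e = h n a * b"
  have e0: "h 0 e = e" using h_mult_left[of 0 n a b] b by (simp add: e_def)
  have eC: "e \<in> C" unfolding e_def using b aC by (intro C_mult h_C)
  have ee: "e * e \<approx> e"
    using cg_right[OF b(3) b(1)] by (simp add: e_def mult.assoc)
  have eI: "e \<notin> I"
  proof
    assume "e \<in> I"
    then have "e * h n a \<in> I" using aC h_C I_mult_right by blast
    then show False using top b(3) cg_I unfolding e_def by blast
  qed
  \<comment> \<open>The factor \<open>b\<close> moves the top component of \<open>a\<close> to
    degree 0, where it becomes \<open>e\<close>; the outer factors place \<open>c\<close> in the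
    corner. The support still has width at most \<open>k\<close>.\<close>
  define c where "c = e * a * b * e"
  have cJ: "c \<in> J" unfolding c_def using a eC b by (intro J_right J_left) auto
  have cC: "c \<in> C" using cJ JC by blast
  have hc: "h i c = e * (h (i + n) a * b) * e" for i
    using h_mult_right[of i "e * a * b" 0 e] h_mult_right[of i "e * a" "- n" b]
      h_mult_left[of "i + n" 0 e a] e0 b by (simp add: c_def mult.assoc)
  have c_top: "h i c \<in> I" if "i > 0" for i
  proof -
    have "h (i + n) a \<in> I" using a(3) that by (auto simp: window_def)
    then show ?thesis unfolding hc by (intro I_mult_right I_mult_left eC b)
  qed
  have c_bot: "h i c \<in> I" if "i < - int k" for i
  proof -
    have "h (i + n) a \<in> I" using a(3) that by (auto simp: window_def)
    then show ?thesis unfolding hc by (intro I_mult_right I_mult_left eC b)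
  qed
  have c0: "h 0 c \<approx> e"
  proof -
    have "h 0 c = e * e * e" using hc[of 0] by (simp add: e_def)
    also have "\<dots> \<approx> e * e" using ee eC cg_right by blast
    also note ee
    finally show ?thesis .
  qed
  have cI: "c \<notin> I" using c0 eI cg_I h_I by blast
  have ec: "e * c \<approx> c"
    using cg_right[OF ee, of "a * b * e"] aC b eC by (simp add: c_def mult.assoc C_mult)
  have ce: "c * e \<approx> c"
    using cg_left[OF ee, of "e * a * b"] aC b eC by (simp add: c_def mult.assoc C_mult)
  have k0: "k > 0"
  proof (rule ccontr)
    assume "\<not> k > 0"
    then have "c \<approx> h 0 c" using c_top c_bot by (intro cg_single_component) (metis int_ops(1) linorder_neqE_linordered_idom minus_zero not_gr_zero)
    also note c0
    finally have "e - c \<in> I" using cg_sym unfolding cg_def by blast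
    then have "e - c \<in> J" using J by blast
    \<comment> \<open>Sums are expressed by differences:
      \<open>e = (e - c) - (0 - c)\<close>.\<close>
    then have "e \<in> J" using J_diff[of "e - c" "0 - c"] J_diff[of 0 c] cJ J I_0 by auto
    then show False using idem ee eI by blast
  qed
  \<comment> \<open>If \<open>z\<close> were in \<open>I\<close>, the support of \<open>c\<close>
    would fit into a window of width \<open>k - 1\<close>.\<close>
  define z where "z = h (- int k) c"
  have zC: "z \<in> C" using cC h_C by (simp add: z_def)
  have hz: "h (- int k) z = z" by (simp add: z_def h_h)
  have zI: "z \<notin> I"
  proof
    assume zI: "z \<in> I"
    have "window 0 (k - 1) c"
      unfolding window_def
    proof (intro allI impI conjI)
      fix i assume i: "h i c \<notin> I"
      show "i \<le> 0" using i c_top[of i] by force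
      have "i \<noteq> - int k" "\<not> i < - int k" using i zI c_bot by (auto simp: z_def)
      then show "0 - int (k - 1) \<le> i" using k0 by simp
    qed
    then show False using min[OF cJ, of 0 "k - 1"] cI k0 by auto
  qed
  have ez: "e * z \<approx> z"
    using h_cg[OF ec, of "- int k"] h_mult_left[of "- int k" 0 e c] e0 by (simp add: z_def)
  have ze: "z * e \<approx> z"
    using h_cg[OF ce, of "- int k"] h_mult_right[of "- int k" c 0 e] e0 by (simp add: z_def)
  \<comment> \<open>In degree \<open>m\<close> the commutator is
    \<open>x * h 0 c - h 0 c * x\<close>, which lies in \<open>I\<close> because
    \<open>h 0 c\<close> acts on \<open>x\<close> like \<open>e\<close>. The rest occupies the
    \<open>k\<close> degrees just below \<open>m\<close>, so minimality puts the whole commutator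
    into \<open>I\<close>.\<close>
  have comm: "x * c \<approx> c * x" if x: "x \<in> C" "h m x = x" "e * x \<approx> x" "x * e \<approx> x" for x m
  proof -
    have hh: "h i (x * c - c * x) = x * h (i - m) c - h (i - m) c * x" for i
      using h_mult_left[of i m x c] h_mult_right[of i c m x] x by (simp add: h_diff)
    have "window (m - 1) (k - 1) (x * c - c * x)"
      unfolding window_def
    proof (intro allI impI)
      fix i assume i: "h i (x * c - c * x) \<notin> I"
      have nz: "h (i - m) c \<notin> I"
        using i x(1) unfolding hh by (auto intro: I_diff I_mult_left I_mult_right)
      have "i \<noteq> m"
      proof
        assume "i = m"
        have "x * h 0 c \<approx> x * e" using c0 x cg_left by blast
        also note x(4)
        also have "x \<approx> e * x" using x(3) cg_sym by blast
        also have "e * x \<approx> h 0 c * x" using cg_sym[OF c0] x cg_right by blast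
        finally show False using i \<open>i = m\<close> unfolding hh by (simp add: cg_def)
      qed
      then show "m - 1 - int (k - 1) \<le> i \<and> i \<le> m - 1"
        using nz c_top[of "i - m"] c_bot[of "i - m"] k0 by force
    qed
    moreover have "x * c - c * x \<in> J" using x cJ by (intro J_diff J_left J_right)
    ultimately show ?thesis unfolding cg_def using min[of _ "m - 1" "k - 1"] k0 by auto
  qed
  obtain d0 where d0: "d0 \<in> C" "h (int k) d0 = d0" "z * d0 * z \<approx> z"
    using homogeneous_regular'[OF cC, of "- int k"] by (auto simp: z_def)
  \<comment> \<open>Cutting \<open>d0\<close> down to the corner makes \<open>comm\<close>
    applicable and keeps a generalized inverse of \<open>z\<close>.\<close>
  define d where "d = e * d0 * e"
  have dC: "d \<in> C" unfolding d_def using d0 eC by (intro C_mult)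
  have hd: "h (int k) d = d"
    using h_mult_right[of "int k" "e * d0" 0 e] h_mult_left[of "int k" 0 e d0] e0 d0
    by (simp add: d_def)
  have ed: "e * d \<approx> d"
    using cg_right[OF ee, of "d0 * e"] d0 eC by (simp add: d_def mult.assoc C_mult)
  have de: "d * e \<approx> d"
    using cg_left[OF ee, of "e * d0"] d0 eC by (simp add: d_def mult.assoc C_mult)
  have zdz: "z * d * z \<approx> z"
  proof -
    have "z * d * z = (z * e) * (d0 * (e * z))" by (simp add: d_def mult.assoc)
    also have "\<dots> \<approx> z * (d0 * (e * z))" using ze d0 eC zC by (intro cg_right C_mult)
    also have "\<dots> \<approx> z * (d0 * z)" using ez d0 zC by (intro cg_left)
    also have "\<dots> = z * d0 * z" by (simp add: mult.assoc)
    also note d0(3)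
    finally show ?thesis .
  qed
  have zc: "z * c \<approx> c * z" using comm[OF zC hz ez ze] .
  have dc: "d * c \<approx> c * d" using comm[OF dC hd ed de] .
  \<comment> \<open>The degree 0 components of \<open>d * c\<close> and \<open>c * d\<close> are
    \<open>d * z\<close> and \<open>z * d\<close>.\<close>
  have dz: "d * z \<approx> z * d"
    using h_cg[OF dc, of 0] h_mult_left[of 0 "int k" d c] h_mult_right[of 0 c "int k" d] hd
    by (simp add: z_def)
  have zzd: "z * z * d \<approx> z"
  proof -
    have "z * z * d = z * (z * d)" by (simp add: mult.assoc)
    also have "\<dots> \<approx> z * (d * z)" using cg_sym[OF dz] zC by (intro cg_left)
    also have "\<dots> = z * d * z" by (simp add: mult.assoc)
    also note zdz
    finally show ?thesis .
  qed
  \<comment> \<open>\<open>f\<close> is the idempotent of the smaller corner in which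
    \<open>z\<close> becomes invertible.\<close>
  define f where "f = z * d"
  have fC: "f \<in> C" unfolding f_def using zC dC by (intro C_mult)
  have f0: "h 0 f = f" using h_mult_left[of 0 "- int k" z d] hz hd by (simp add: f_def)
  have ff: "f * f \<approx> f" using cg_right[OF zdz dC] by (simp add: f_def mult.assoc)
  \<comment> \<open>\<open>w\<close> lives in degrees \<open>-2k\<close> to \<open>-k\<close>, with
    bottom component \<open>z * z\<close>. All these degrees are negative, so a quasi-inverse would
    need a negative top degree and a nonnegative bottom degree.\<close>
  define w where "w = c * z"
  have wJ: "w \<in> J" unfolding w_def using cJ zC by (intro J_right)
  have wC: "w \<in> C" using wJ JC by blast
  have wf: "w * f \<approx> w"
    using cg_left[OF zzd cC] by (simp add: w_def f_def mult.assoc)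
  have fw: "f * w \<approx> w"
  proof -
    have "f * w = z * (d * c) * z" by (simp add: f_def w_def mult.assoc)
    also have "\<dots> \<approx> z * (c * d) * z" using dc zC by (intro cg_left cg_right)
    also have "\<dots> = (z * c) * (d * z)" by (simp add: mult.assoc)
    also have "\<dots> \<approx> (c * z) * (d * z)" using zc zC dC by (intro cg_right C_mult)
    also have "\<dots> = c * (z * d * z)" by (simp add: mult.assoc)
    also have "\<dots> \<approx> c * z" using zdz cC by (intro cg_left)
    finally show ?thesis by (simp add: w_def)
  qed
  obtain u where u: "u \<in> C" "w \<approx> u - u * w" using quasi_regular[OF wJ] by blast
  \<comment> \<open>This \<open>x\<close> still satisfies the quasi-inverse equation, and
    \<open>x * f \<approx> x\<close> allows \<open>z\<close> to be cancelled on its right.\<close>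
  define x where "x = u * f"
  have xC: "x \<in> C" unfolding x_def using u fC by (intro C_mult)
  have xf: "x * f \<approx> x" using cg_left[OF ff u(1)] by (simp add: x_def mult.assoc)
  have xw: "w \<approx> x - x * w"
  proof -
    have "w \<approx> w * f" using wf by (rule cg_sym)
    also have "w * f \<approx> (u - u * w) * f" using u fC by (intro cg_right)
    also have "\<dots> = x - u * (w * f)" by (simp add: x_def algebra_simps)
    also have "\<dots> \<approx> x - u * w" using wf u by (intro cg_diff cg_left cg_refl)
    also have "\<dots> \<approx> x - u * (f * w)" using cg_sym[OF fw] u by (intro cg_diff cg_left cg_refl)
    also have "\<dots> = x - x * w" by (simp add: x_def mult.assoc)
    finally show ?thesis .
  qed
  have hw: "h i w = h (i + int k) c * z" for i
    using h_mult_right[of i c "- int k" z] hz by (simp add: w_def)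
  have w_top: "h i w \<in> I" if "i > - int k" for i
    unfolding hw using that c_top[of "i + int k"] zC by (intro I_mult_right) auto
  have w_bot: "h i w \<in> I" if "i < - 2 * int k" for i
    unfolding hw using that c_bot[of "i + int k"] zC by (intro I_mult_right) auto
  have hw2: "h (- 2 * int k) w = z * z" using hw[of "- 2 * int k"] by (simp add: z_def)
  have zzI: "z * z \<notin> I"
    using zzd zI dC cg_I I_mult_right by blast
  have wI: "w \<notin> I" using hw2 zzI h_I by metis
  have xI: "x \<notin> I"
  proof
    assume "x \<in> I"
    then have "x - x * w \<in> I" using wC by (intro I_diff I_mult_right)
    then show False using xw wI cg_I by blast
  qed
  obtain t where t: "h t x \<notin> I" "\<And>i. i > t \<Longrightarrow> h i x \<in> I"
    using obtain_top_component[OF xI] by blast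
  obtain m where m: "h m x \<notin> I" "\<And>i. i < m \<Longrightarrow> h i x \<in> I"
    using obtain_bottom_component[OF xI] by blast
  have tm: "m \<le> t" using t m by force
  \<comment> \<open>The top degree of \<open>w\<close> is at most \<open>-k\<close>, so
    \<open>x * w\<close> stays below the top degree \<open>t\<close> of \<open>x\<close>. Then
    \<open>w\<close> itself must have a component in degree \<open>t\<close>.\<close>
  have "h t (x * w) \<in> I"
  proof (rule h_mult_I[OF xC wC])
    fix j show "h j x \<in> I \<or> h (t - j) w \<in> I"
      using t(2)[of j] w_top[of "t - j"] k0 by force
  qed
  then have "h t w \<notin> I"
    using h_cg[OF xw, of t] t(1) unfolding h_diff by (metis I_add cg_I diff_add_cancel)
  then have t_neg: "t \<le> - int k" using w_top by force
  have bottom: "h (m - 2 * int k) (x * w) \<approx> h m x * (z * z)"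
  proof -
    have "h (m - 2 * int k) (x * w) \<approx> h m x * h (m - 2 * int k - m) w"
    proof (rule h_mult_cg[OF xC wC])
      fix j assume "j \<noteq> m"
      then show "h j x \<in> I \<or> h (m - 2 * int k - j) w \<in> I"
        using m(2)[of j] w_bot[of "m - 2 * int k - j"] by force
    qed
    then show ?thesis using hw2 by simp
  qed
  \<comment> \<open>Two factors \<open>d\<close> on the right reduce \<open>z * z\<close> to
    \<open>f\<close>, which fixes \<open>x\<close> from the right.\<close>
  have "h m x * (z * z) \<notin> I"
  proof
    assume "h m x * (z * z) \<in> I"
    then have "h m x * (z * z) * d * d \<in> I" using dC I_mult_right by blast
    moreover have "h m x * (z * z) * d * d \<approx> h m x"
    proof -
      have "h m x * (z * z) * d * d = h m x * ((z * z * d) * d)" by (simp add: mult.assoc)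
      also have "\<dots> \<approx> h m x * f"
        unfolding f_def using zzd dC xC by (intro cg_left cg_right h_C)
      also have "\<dots> = h m (x * f)" using h_mult_right[of m x 0 f] f0 by simp
      also have "\<dots> \<approx> h m x" using xf by (rule h_cg)
      finally show ?thesis .
    qed
    ultimately show False using m(1) cg_I by blast
  qed
  then have "h (m - 2 * int k) (x * w) \<notin> I" using bottom cg_I by blast
  \<comment> \<open>Below its bottom degree \<open>x\<close> contributes nothing, so
    \<open>w\<close> has to balance this component of \<open>x * w\<close>. As \<open>w\<close> has
    nothing below \<open>-2k\<close>, \<open>m\<close> is nonnegative, against
    \<open>m \<le> t < 0\<close>.\<close>
  moreover have "h (m - 2 * int k) x \<in> I" using m(2) k0 by simp
  ultimately have "h (m - 2 * int k) w \<notin> I"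
    using h_cg[OF xw, of "m - 2 * int k"] unfolding h_diff by (metis I_diff cg_I diff_add_cancel add_diff_cancel_left')
  then have "m \<ge> 0" using w_bot[of "m - 2 * int k"] by force
  with tm t_neg k0 show False by simp
qed

end

text \<open>McCoy's lemma, relative to a set \<open>Y\<close> that records where the generalized
  inverses are found.\<close>

lemma (in ideal_mod) regular_mccoy:
  assumes x: "x \<in> C" and Y: "y \<in> Y" "z \<in> Y" "Y \<subseteq> C"
    and closed: "\<And>u v. u \<in> Y \<Longrightarrow> v \<in> Y \<Longrightarrow> u + v \<in> Y" "\<And>u v. u \<in> Y \<Longrightarrow> v \<in> Y \<Longrightarrow> u - v \<in> Y"
      "\<And>u v. u \<in> Y \<Longrightarrow> v \<in> Y \<Longrightarrow> u * x * v \<in> Y"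
    and z: "(x - x * y * x) * z * (x - x * y * x) \<approx> x - x * y * x"
  shows "\<exists>z\<in>Y. x * z * x \<approx> x"
proof
  \<comment> \<open>This is \<open>y + (1 - y x) z (1 - x y)\<close>, multiplied out because no
    identity is available.\<close>
  let ?Y = "y + (z - z * x * y - y * x * z + y * x * (z * x * y))"
  show "?Y \<in> Y" using Y(1,2) by (intro closed)
  have "x * ?Y * x = x * y * x + (x - x * y * x) * z * (x - x * y * x)"
    by (simp add: algebra_simps)
  also have "\<dots> \<approx> x * y * x + (x - x * y * x)" using z by (intro cg_add cg_refl)
  finally show "x * ?Y * x \<approx> x" by simp
qed

section \<open>The grading of the free algebra\<close>

fun lpa_deg :: "('v, 'e) lpa_gen \<Rightarrow> int" where
  "lpa_deg (Vertex v) = 0"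
| "lpa_deg (Edge f) = 1"
| "lpa_deg (Ghost f) = - 1"

definition word_deg :: "('v, 'e) lpa_gen word \<Rightarrow> int" where
  "word_deg w = (\<Sum>g\<leftarrow>letters w. lpa_deg g)"

lemma word_deg_plus: "word_deg (u + w) = word_deg u + word_deg w"
  by (simp add: word_deg_def plus_word_def)

lemma word_deg_zero [simp]: "word_deg 0 = 0"
  by (simp add: word_deg_def zero_word_def)

lemma poly_mapping_sum_single:
  fixes p :: "'a \<Rightarrow>\<^sub>0 'b::comm_monoid_add"
  shows "(\<Sum>w\<in>Poly_Mapping.keys p. Poly_Mapping.single w (Poly_Mapping.lookup p w)) = p"
  by (rule poly_mapping_eqI)
    (auto simp: lookup_sum lookup_single when_def in_keys_iff sum.delta)

text \<open>Written as a sum of one-word terms, so that finite support is automatic and products can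
  be checked on single words.\<close>

definition hcomp :: "int \<Rightarrow> ('v, 'e, 'r::ring_1) free_alg \<Rightarrow> ('v, 'e, 'r) free_alg" where
  "hcomp n p = (\<Sum>w | w \<in> Poly_Mapping.keys p \<and> word_deg w = n. Poly_Mapping.single w (Poly_Mapping.lookup p w))"

lemma lookup_hcomp:
  "Poly_Mapping.lookup (hcomp n p) w = (if word_deg w = n then Poly_Mapping.lookup p w else 0)"
  by (auto simp: hcomp_def lookup_sum lookup_single when_def in_keys_iff sum.delta)

lemma hcomp_add: "hcomp n (p + q) = hcomp n p + hcomp n q"
  by (rule poly_mapping_eqI) (simp add: lookup_hcomp lookup_add)

lemma hcomp_diff: "hcomp n (p - q) = hcomp n p - hcomp n q"
  by (rule poly_mapping_eqI) (simp add: lookup_hcomp lookup_minus)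

lemma hcomp_zero [simp]: "hcomp n 0 = 0"
  by (rule poly_mapping_eqI) (simp add: lookup_hcomp)

lemma hcomp_sum: "hcomp n (sum f A) = (\<Sum>x\<in>A. hcomp n (f x))"
  by (induction A rule: infinite_finite_induct) (auto simp: hcomp_add)

lemma hcomp_single:
  "hcomp n (Poly_Mapping.single w r) = (if word_deg w = n then Poly_Mapping.single w r else 0)"
  by (rule poly_mapping_eqI) (auto simp: lookup_hcomp lookup_single when_def)

lemma hcomp_hcomp: "hcomp m (hcomp n p) = (if m = n then hcomp n p else 0)"
  by (rule poly_mapping_eqI) (auto simp: lookup_hcomp)

lemma keys_hcomp: "Poly_Mapping.keys (hcomp n p) = {w \<in> Poly_Mapping.keys p. word_deg w = n}"
  by (auto simp: in_keys_iff lookup_hcomp split: if_splits)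

lemma finite_hcomp: "finite {n. hcomp n p \<noteq> 0}"
proof (rule finite_subset)
  show "{n. hcomp n p \<noteq> 0} \<subseteq> word_deg ` Poly_Mapping.keys p"
  proof
    fix n assume "n \<in> {n. hcomp n p \<noteq> 0}"
    then have "Poly_Mapping.keys (hcomp n p) \<noteq> {}" by simp
    then show "n \<in> word_deg ` Poly_Mapping.keys p" by (auto simp: keys_hcomp)
  qed
qed simp

lemma sum_hcomp: "(\<Sum>n | hcomp n p \<noteq> 0. hcomp n p) = p"
proof (rule poly_mapping_eqI)
  fix w
  have "Poly_Mapping.lookup (\<Sum>n | hcomp n p \<noteq> 0. hcomp n p) w =
      (\<Sum>n | hcomp n p \<noteq> 0. if word_deg w = n then Poly_Mapping.lookup p w else 0)"
    by (simp add: lookup_sum lookup_hcomp)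
  also have "\<dots> = (if hcomp (word_deg w) p \<noteq> 0 then Poly_Mapping.lookup p w else 0)"
    by (subst sum.delta'[OF finite_hcomp]) simp
  also have "\<dots> = Poly_Mapping.lookup p w"
    using lookup_hcomp[of "word_deg w" p w] by auto
  finally show "Poly_Mapping.lookup (\<Sum>n | hcomp n p \<noteq> 0. hcomp n p) w = Poly_Mapping.lookup p w" .
qed

lemma hcomp_single_mult:
  "hcomp n (Poly_Mapping.single w r * p) = Poly_Mapping.single w r * hcomp (n - word_deg w) p"
proof -
  have "hcomp n (Poly_Mapping.single w r * p) =
      (\<Sum>u\<in>Poly_Mapping.keys p. hcomp n (Poly_Mapping.single w r * Poly_Mapping.single u (Poly_Mapping.lookup p u)))"
    by (subst poly_mapping_sum_single[of p, symmetric]) (simp add: sum_distrib_left hcomp_sum)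
  also have "\<dots> = (\<Sum>u\<in>Poly_Mapping.keys p. Poly_Mapping.single w r * hcomp (n - word_deg w) (Poly_Mapping.single u (Poly_Mapping.lookup p u)))"
    by (intro sum.cong) (auto simp: mult_single hcomp_single word_deg_plus)
  also have "\<dots> = Poly_Mapping.single w r * hcomp (n - word_deg w) p"
    by (subst (3) poly_mapping_sum_single[of p, symmetric]) (simp add: sum_distrib_left hcomp_sum)
  finally show ?thesis .
qed

lemma hcomp_mult_single:
  "hcomp n (p * Poly_Mapping.single w r) = hcomp (n - word_deg w) p * Poly_Mapping.single w r"
proof -
  have "hcomp n (p * Poly_Mapping.single w r) =
      (\<Sum>u\<in>Poly_Mapping.keys p. hcomp n (Poly_Mapping.single u (Poly_Mapping.lookup p u) * Poly_Mapping.single w r))"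
    by (subst poly_mapping_sum_single[of p, symmetric]) (simp add: sum_distrib_right hcomp_sum)
  also have "\<dots> = (\<Sum>u\<in>Poly_Mapping.keys p. hcomp (n - word_deg w) (Poly_Mapping.single u (Poly_Mapping.lookup p u)) * Poly_Mapping.single w r)"
    by (intro sum.cong) (auto simp: mult_single hcomp_single word_deg_plus)
  also have "\<dots> = hcomp (n - word_deg w) p * Poly_Mapping.single w r"
    by (subst (3) poly_mapping_sum_single[of p, symmetric]) (simp add: sum_distrib_right hcomp_sum)
  finally show ?thesis .
qed

lemma hcomp_mult_left: "hcomp n (hcomp m p * q) = hcomp m p * hcomp (n - m) q"
  by (simp add: hcomp_def[of m p] sum_distrib_right hcomp_sum hcomp_single_mult)

lemma hcomp_mult_right: "hcomp n (p * hcomp m q) = hcomp (n - m) p * hcomp m q"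
  by (simp add: hcomp_def[of m q] sum_distrib_left hcomp_sum hcomp_mult_single)

text \<open>Each defining relation involves words of one degree only, which is why the ideal is
  graded.\<close>

lemma hcomp_relation:
  assumes "p \<in> lpa_relations E"
  shows "hcomp n p = p \<or> hcomp n p = 0"
  using assms
  by cases
    (auto simp: gen_word_def hcomp_diff hcomp_sum hcomp_single word_deg_def)

lemma lpa_ideal_sum: "(\<And>x. x \<in> A \<Longrightarrow> f x \<in> lpa_ideal E) \<Longrightarrow> sum f A \<in> lpa_ideal E"
  by (induction A rule: infinite_finite_induct) (auto intro: lpa_ideal.zero lpa_ideal.add)

text \<open>Multiplying by a single word shifts degrees, so a general multiplier is split into
  words; hence the induction is over all \<open>n\<close> at once.\<close>

lemma hcomp_ideal: "p \<in> lpa_ideal E \<Longrightarrow> hcomp n p \<in> lpa_ideal E"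
proof (induction arbitrary: n rule: lpa_ideal.induct)
  case (relation p)
  then show ?case using hcomp_relation[of p E n] by (auto intro: lpa_ideal.intros)
next
  case (mult_left p a)
  have "hcomp n (a * p) = (\<Sum>w\<in>Poly_Mapping.keys a.
      Poly_Mapping.single w (Poly_Mapping.lookup a w) * hcomp (n - word_deg w) p)"
    by (subst poly_mapping_sum_single[of a, symmetric])
      (simp add: sum_distrib_right hcomp_sum hcomp_single_mult)
  also have "\<dots> \<in> lpa_ideal E"
    by (intro lpa_ideal_sum lpa_ideal.mult_left mult_left.IH) (use mult_left.hyps in \<open>auto simp: free_alg_carrier_def\<close>)
  finally show ?case .
next
  case (mult_right p a)
  have "hcomp n (p * a) = (\<Sum>w\<in>Poly_Mapping.keys a.
      hcomp (n - word_deg w) p * Poly_Mapping.single w (Poly_Mapping.lookup a w))"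
    by (subst poly_mapping_sum_single[of a, symmetric])
      (simp add: sum_distrib_left hcomp_sum hcomp_mult_single)
  also have "\<dots> \<in> lpa_ideal E"
    by (intro lpa_ideal_sum lpa_ideal.mult_right mult_right.IH) (use mult_right.hyps in \<open>auto simp: free_alg_carrier_def\<close>)
  finally show ?case .
qed (auto simp: hcomp_add lpa_scalar_def hcomp_single_mult hcomp_mult_single
  intro: lpa_ideal.intros(2,3) lpa_ideal.scalar_left[unfolded lpa_scalar_def] lpa_ideal.scalar_right[unfolded lpa_scalar_def])

section \<open>Monomials in the Leavitt path algebra\<close>

definition coeff_word :: "'r \<Rightarrow> ('v, 'e) lpa_gen list \<Rightarrow> ('v, 'e, 'r::ring_1) free_alg" where
  "coeff_word r gs = Poly_Mapping.single (Word gs) r"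

lemma coeff_word_mult: "coeff_word r gs * coeff_word s hs = coeff_word (r * s) (gs @ hs)"
  by (simp add: coeff_word_def mult_single plus_word_def)

lemma coeff_word_add: "coeff_word r gs + coeff_word s gs = coeff_word (r + s) gs"
  by (simp add: coeff_word_def single_add)

lemma coeff_word_zero [simp]: "coeff_word 0 gs = 0"
  by (simp add: coeff_word_def)

lemma coeff_word_uminus: "- coeff_word r gs = coeff_word (- r) gs"
  by (simp add: coeff_word_def single_uminus)

text \<open>The parameter \<open>ty\<close> only ties the coefficient type to the locale.\<close>

locale lpa = wf_digraph E for E :: "('v, 'e) pre_digraph" +
  fixes ty :: "'r::ring_1 itself"
begin

abbreviation K :: "('v, 'e, 'r) free_alg set" where "K \<equiv> lpa_ideal E"

text \<open>
  Admitting the empty word makes scalars and trivial path segments available as factors.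
\<close>

definition free_alg_unital :: "('v, 'e, 'r) free_alg set" where
  "free_alg_unital = {p. \<forall>w\<in>Poly_Mapping.keys p. set (letters w) \<subseteq> lpa_gens E}"

lemma coeff_word_unital: "set gs \<subseteq> lpa_gens E \<Longrightarrow> coeff_word r gs \<in> free_alg_unital"
  by (auto simp: coeff_word_def free_alg_unital_def)

lemma carrier_subset_unital: "free_alg_carrier E \<subseteq> free_alg_unital"
  by (auto simp: free_alg_unital_def free_alg_carrier_def)

lemma K_uminus: "p \<in> K \<Longrightarrow> - p \<in> K"
proof -
  assume "p \<in> K"
  then have "lpa_scalar (- 1) * p \<in> K" by (rule lpa_ideal.scalar_left)
  then show ?thesis by (simp add: lpa_scalar_def single_uminus)
qed

lemma word_cases: "w = 0 \<or> letters w \<noteq> []"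
  by (cases w) (auto simp: zero_word_def)

text \<open>The term of the empty word acts as a scalar and is covered by the scalar closure rules;
  all other terms lie in the free algebra.\<close>

lemma K_mult:
  assumes a: "a \<in> free_alg_unital" and p: "p \<in> K"
  shows "a * p \<in> K" "p * a \<in> K"
proof -
  let ?s = "\<lambda>w. Poly_Mapping.single w (Poly_Mapping.lookup a w)"
  have "?s w * p \<in> K \<and> p * ?s w \<in> K" if w: "w \<in> Poly_Mapping.keys a" for w
  proof (cases "w = 0")
    case True
    then show ?thesis
      using lpa_ideal.scalar_left[OF p] lpa_ideal.scalar_right[OF p] by (simp add: lpa_scalar_def)
  next
    case False
    then have "?s w \<in> free_alg_carrier E"
      using w a word_cases[of w] by (auto simp: free_alg_carrier_def free_alg_unital_def)
    then show ?thesis using p by (auto intro: lpa_ideal.mult_left lpa_ideal.mult_right)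
  qed
  then have "(\<Sum>w\<in>Poly_Mapping.keys a. ?s w * p) \<in> K" "(\<Sum>w\<in>Poly_Mapping.keys a. p * ?s w) \<in> K"
    by (auto intro!: lpa_ideal_sum)
  then show "a * p \<in> K" "p * a \<in> K"
    by (simp_all add: poly_mapping_sum_single flip: sum_distrib_left sum_distrib_right)
qed

lemma K_carrier: "K \<subseteq> free_alg_carrier E"
  by (rule lpa_ideal_subset) unfold_locales

sublocale ideal_mod free_alg_unital K
proof
  fix x y :: "('v, 'e, 'r) free_alg"
  show "x + y \<in> free_alg_unital" if "x \<in> free_alg_unital" "y \<in> free_alg_unital"
    using that keys_add[of x y] unfolding free_alg_unital_def by blast
  show "x * y \<in> free_alg_unital" if "x \<in> free_alg_unital" "y \<in> free_alg_unital"
    using that keys_mult[of x y] unfolding free_alg_unital_def by (fastforce simp: plus_word_def)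
qed (use K_mult K_uminus K_carrier carrier_subset_unital in \<open>auto simp: free_alg_unital_def intro: lpa_ideal.intros\<close>)

notation cg (infix "\<approx>" 50)

section \<open>Rewriting words by the defining relations\<close>

abbreviation W :: "('v, 'e) lpa_gen list \<Rightarrow> ('v, 'e, 'r) free_alg" where
  "W gs \<equiv> coeff_word 1 gs"

lemma coeff_word_split: "coeff_word r (xs @ gs @ ys) = coeff_word r xs * W gs * W ys"
  by (simp add: coeff_word_mult)

lemma cg_context:
  assumes "W gs \<approx> W hs" "set xs \<subseteq> lpa_gens E" "set ys \<subseteq> lpa_gens E"
  shows "coeff_word r (xs @ gs @ ys) \<approx> coeff_word r (xs @ hs @ ys)"
  unfolding coeff_word_split using assms by (intro cg_left cg_right coeff_word_unital)

lemma K_context: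
  assumes "W gs \<in> K" "set xs \<subseteq> lpa_gens E" "set ys \<subseteq> lpa_gens E"
  shows "coeff_word r (xs @ gs @ ys) \<in> K"
  unfolding coeff_word_split using assms by (intro I_mult_left I_mult_right coeff_word_unital)

lemma gens [simp]:
  "Vertex v \<in> lpa_gens E \<longleftrightarrow> v \<in> verts E" "Edge f \<in> lpa_gens E \<longleftrightarrow> f \<in> arcs E"
  "Ghost f \<in> lpa_gens E \<longleftrightarrow> f \<in> arcs E"
  by (auto simp: lpa_gens_def)

lemma lpa_cg:
  "v \<in> verts E \<Longrightarrow> W [Vertex v, Vertex v] \<approx> W [Vertex v]"
  "\<lbrakk>v \<in> verts E; v' \<in> verts E; v \<noteq> v'\<rbrakk> \<Longrightarrow> W [Vertex v, Vertex v'] \<in> K"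
  "f \<in> arcs E \<Longrightarrow> W [Vertex (tail E f), Edge f] \<approx> W [Edge f]"
  "f \<in> arcs E \<Longrightarrow> W [Edge f, Vertex (head E f)] \<approx> W [Edge f]"
  "f \<in> arcs E \<Longrightarrow> W [Vertex (head E f), Ghost f] \<approx> W [Ghost f]"
  "f \<in> arcs E \<Longrightarrow> W [Ghost f, Vertex (tail E f)] \<approx> W [Ghost f]"
  "f \<in> arcs E \<Longrightarrow> W [Ghost f, Edge f] \<approx> W [Vertex (head E f)]"
  "\<lbrakk>f \<in> arcs E; g \<in> arcs E; f \<noteq> g\<rbrakk> \<Longrightarrow> W [Ghost f, Edge g] \<in> K"
  using lpa_relations.intros(1-6)[where ?'r = 'r, THEN lpa_ideal.relation, of _ E]
  by (fastforce simp: cg_def coeff_word_def gen_word_def split: if_splits)+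

text \<open>A path is an edge list with its end vertex \<open>v\<close>; for the empty list
  \<open>v\<close> is also the source.\<close>

fun path_src :: "'e list \<Rightarrow> 'v \<Rightarrow> 'v" where
  "path_src [] v = v"
| "path_src (f # \<alpha>) v = tail E f"

fun path_to :: "'e list \<Rightarrow> 'v \<Rightarrow> bool" where
  "path_to [] v \<longleftrightarrow> v \<in> verts E"
| "path_to (f # \<alpha>) v \<longleftrightarrow> f \<in> arcs E \<and> head E f = path_src \<alpha> v \<and> path_to \<alpha> v"

lemma path_src_verts: "path_to \<alpha> v \<Longrightarrow> path_src \<alpha> v \<in> verts E"
  by (cases \<alpha>) auto

lemma path_to_snoc: "\<lbrakk>path_to \<beta> (tail E f); f \<in> arcs E\<rbrakk> \<Longrightarrow> path_to (\<beta> @ [f]) (head E f)"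
proof (induction \<beta>)
  case (Cons g \<beta>)
  then show ?case by (cases \<beta>) auto
qed auto

lemma path_to_verts: "path_to \<alpha> v \<Longrightarrow> v \<in> verts E"
  by (induction \<alpha>) auto

lemma path_to_arcs: "path_to \<alpha> v \<Longrightarrow> set \<alpha> \<subseteq> arcs E"
  by (induction \<alpha>) auto

text \<open>The trailing vertex keeps the word of an empty path nonempty, so it lies in the algebra
  without identity.\<close>

definition real_path :: "'e list \<Rightarrow> 'v \<Rightarrow> ('v, 'e) lpa_gen list" where
  "real_path \<alpha> v = map Edge \<alpha> @ [Vertex v]"

lemma real_path_gens: "path_to \<alpha> v \<Longrightarrow> set (real_path \<alpha> v) \<subseteq> lpa_gens E"
  using path_to_arcs path_to_verts by (force simp: real_path_def)

lemma real_path_simps: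
  "real_path [] v = [Vertex v]" "real_path (f # \<alpha>) v = Edge f # real_path \<alpha> v"
  by (simp_all add: real_path_def)

section \<open>Generators acting on paths from the left\<close>

lemma vertex_path: "path_to \<alpha> v \<Longrightarrow> W (Vertex (path_src \<alpha> v) # real_path \<alpha> v) \<approx> W (real_path \<alpha> v)"
proof (cases \<alpha>)
  case (Cons f \<alpha>')
  assume "path_to \<alpha> v"
  then show ?thesis
    using cg_context[OF lpa_cg(3)[of f], of "[]" "real_path \<alpha>' v" 1] real_path_gens[of \<alpha>' v]
    by (simp add: Cons real_path_simps)
qed (use lpa_cg(1) in \<open>simp add: real_path_simps\<close>)

text \<open>Inserting the source vertex in front of the path brings two distinct, hence orthogonal,
  vertices together.\<close>

lemma vertex_path_zero:
  assumes "path_to \<alpha> v" "u \<in> verts E" "u \<noteq> path_src \<alpha> v"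
  shows "W (Vertex u # real_path \<alpha> v) \<in> K"
proof -
  have "W (Vertex u # real_path \<alpha> v) \<approx> W (Vertex u # Vertex (path_src \<alpha> v) # real_path \<alpha> v)"
    using cg_context[OF vertex_path[OF assms(1), THEN cg_sym], of "[Vertex u]" "[]"] assms(2) by simp
  moreover have "W (Vertex u # Vertex (path_src \<alpha> v) # real_path \<alpha> v) \<in> K"
    using K_context[OF lpa_cg(2)[of u "path_src \<alpha> v"], of "[]" "real_path \<alpha> v" 1] assms
      real_path_gens path_src_verts by simp
  ultimately show ?thesis using cg_I by blast
qed

lemma edge_path_zero:
  assumes "path_to \<alpha> v" "f \<in> arcs E" "head E f \<noteq> path_src \<alpha> v"
  shows "W (Edge f # real_path \<alpha> v) \<in> K"
proof -
  have "W (Edge f # real_path \<alpha> v) \<approx> W (Edge f # Vertex (head E f) # real_path \<alpha> v)"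
    using cg_context[OF lpa_cg(4)[THEN cg_sym], of f "[]" "real_path \<alpha> v" 1] assms real_path_gens by simp
  moreover have "W (Edge f # Vertex (head E f) # real_path \<alpha> v) \<in> K"
    using K_context[OF vertex_path_zero[OF assms(1) _ assms(3)], of "[Edge f]" "[]" 1] assms(2) by simp
  ultimately show ?thesis using cg_I by blast
qed

lemma ghost_path:
  assumes "path_to (f # \<alpha>) v"
  shows "W (Ghost f # real_path (f # \<alpha>) v) \<approx> W (real_path \<alpha> v)"
proof -
  have "W (Ghost f # real_path (f # \<alpha>) v) \<approx> W (Vertex (head E f) # real_path \<alpha> v)"
    using cg_context[OF lpa_cg(7), of f "[]" "real_path \<alpha> v" 1] assms real_path_gens[of \<alpha> v]
    by (simp add: real_path_simps)
  also have "\<dots> \<approx> W (real_path \<alpha> v)" using vertex_path[of \<alpha> v] assms by simp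
  finally show ?thesis .
qed

lemma ghost_path_zero:
  assumes "path_to (g # \<alpha>) v" "f \<in> arcs E" "f \<noteq> g"
  shows "W (Ghost f # real_path (g # \<alpha>) v) \<in> K"
  using K_context[OF lpa_cg(8)[of f g], of "[]" "real_path \<alpha> v" 1] assms real_path_gens[of \<alpha> v]
  by (simp add: real_path_simps)

text \<open>Both words equal the ghost edge. This moves a vertex past a ghost edge into the place it
  has in a monomial.\<close>

lemma ghost_vertex: "f \<in> arcs E \<Longrightarrow> W [Ghost f, Vertex (tail E f)] \<approx> W [Vertex (head E f), Ghost f]"
  using lpa_cg(5,6) cg_sym cg_trans by blast

lemma ghost_vertex_zero:
  assumes "f \<in> arcs E" "v \<in> verts E" "v \<noteq> tail E f"
  shows "W [Ghost f, Vertex v] \<in> K"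
proof -
  have "W [Ghost f, Vertex v] \<approx> W [Ghost f, Vertex (tail E f), Vertex v]"
    using cg_context[OF lpa_cg(6)[THEN cg_sym], of f "[]" "[Vertex v]" 1] assms by simp
  moreover have "W [Ghost f, Vertex (tail E f), Vertex v] \<in> K"
    using K_context[OF lpa_cg(2)[of "tail E f" v], of "[Ghost f]" "[]" 1] assms by simp
  ultimately show ?thesis using cg_I by blast
qed

text \<open>The element \<open>r \<alpha> v \<beta>\<^sup>*\<close>; the reversal is there because
  the involution reverses paths.\<close>

definition monomial :: "'r \<Rightarrow> 'e list \<times> 'v \<times> 'e list \<Rightarrow> ('v, 'e, 'r) free_alg" where
  "monomial r t = (case t of (\<alpha>, v, \<beta>) \<Rightarrow> coeff_word r (real_path \<alpha> v @ map Ghost (rev \<beta>)))"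

text \<open>The end vertex is recorded because the empty edge list is a path at every vertex.\<close>

definition paths :: "nat \<Rightarrow> ('e list \<times> 'v) set" where
  "paths p = {(\<alpha>, v). path_to \<alpha> v \<and> length \<alpha> = p}"

definition pairs :: "('e list \<times> 'v) set \<Rightarrow> ('e list \<times> 'v) set \<Rightarrow> ('e list \<times> 'v \<times> 'e list) set" where
  "pairs P Q = {(\<alpha>, v, \<beta>). (\<alpha>, v) \<in> P \<and> (\<beta>, v) \<in> Q}"

abbreviation level :: "nat \<Rightarrow> nat \<Rightarrow> ('e list \<times> 'v \<times> 'e list) set" where
  "level p q \<equiv> pairs (paths p) (paths q)"

text \<open>Including \<open>K\<close> makes the span closed under congruence and gives
  \<open>K\<close> as the span of the empty set.\<close>

inductive_set lspan :: "('e list \<times> 'v \<times> 'e list) set \<Rightarrow> ('v, 'e, 'r) free_alg set"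
  for T :: "('e list \<times> 'v \<times> 'e list) set" where
  ideal: "x \<in> K \<Longrightarrow> x \<in> lspan T"
| mono: "t \<in> T \<Longrightarrow> monomial r t \<in> lspan T"
| add: "\<lbrakk>x \<in> lspan T; y \<in> lspan T\<rbrakk> \<Longrightarrow> x + y \<in> lspan T"

section \<open>Closure properties of spans\<close>

lemma lspan_mono: "S \<subseteq> T \<Longrightarrow> lspan S \<subseteq> lspan T"
proof
  fix x assume "S \<subseteq> T" "x \<in> lspan S"
  from this(2,1) show "x \<in> lspan T"
    by induction (auto intro: lspan.intros)
qed

lemma lspan_empty: "lspan {} = K"
proof
  show "lspan {} \<subseteq> K"
  proof
    fix x assume "x \<in> lspan {}"
    then show "x \<in> K" by induction (auto intro: I_add)
  qed
qed (auto intro: lspan.ideal)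

lemma lspan_uminus: "x \<in> lspan T \<Longrightarrow> - x \<in> lspan T"
proof (induction rule: lspan.induct)
  case (mono t r)
  have "- monomial r t = monomial (- r) t"
    by (simp add: monomial_def coeff_word_uminus split: prod.split)
  then show ?case using mono by (simp add: lspan.mono)
next
  case (add x y)
  then show ?case using lspan.add[of "- x" T "- y"] by simp
qed (auto intro: lspan.ideal I_uminus)

lemma lspan_diff: "\<lbrakk>x \<in> lspan T; y \<in> lspan T\<rbrakk> \<Longrightarrow> x - y \<in> lspan T"
  using lspan.add[of x T "- y"] lspan_uminus[of y T] by simp

lemma lspan_cg: "\<lbrakk>x \<approx> y; y \<in> lspan T\<rbrakk> \<Longrightarrow> x \<in> lspan T"
  using lspan.add[of "x - y" T y] lspan.ideal[of "x - y" T] by (simp add: cg_def)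

lemma lspan_Un:
  assumes "x \<in> lspan (S \<union> T)"
  shows "\<exists>y\<in>lspan S. \<exists>z\<in>lspan T. x = y + z"
  using assms
proof (induction rule: lspan.induct)
  case (ideal x)
  then show ?case using lspan.ideal[of x S] lspan.ideal[OF I_0, of T] by force
next
  case (mono t r)
  then show ?case
    using lspan.mono[of t S r] lspan.mono[of t T r] lspan.ideal[OF I_0] by (metis Un_iff add_0 add.right_neutral)
next
  case (add x x')
  then obtain y z y' z' where "y \<in> lspan S" "z \<in> lspan T" "x = y + z"
    "y' \<in> lspan S" "z' \<in> lspan T" "x' = y' + z'" by blast
  then show ?case
    by (intro bexI[of _ "y + y'"] bexI[of _ "z + z'"]) (auto intro: lspan.add)
qed

lemma monomial_carrier:
  assumes "t \<in> level p q" shows "monomial r t \<in> free_alg_carrier E"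
proof -
  obtain \<alpha> v \<beta> where t: "t = (\<alpha>, v, \<beta>)" "path_to \<alpha> v" "path_to \<beta> v"
    using assms by (auto simp: pairs_def paths_def)
  then have "set (real_path \<alpha> v @ map Ghost (rev \<beta>)) \<subseteq> lpa_gens E"
    using path_to_arcs[of \<beta> v] real_path_gens[of \<alpha> v] by auto
  then show ?thesis
    by (auto simp: t(1) monomial_def coeff_word_def free_alg_carrier_def real_path_def)
qed

lemma lspan_carrier:
  assumes "x \<in> lspan T" "\<And>t. t \<in> T \<Longrightarrow> \<exists>p q. t \<in> level p q"
  shows "x \<in> free_alg_carrier E"
  using assms
proof (induction rule: lspan.induct)
  case (ideal x)
  then show ?case using K_carrier by blast
next
  case (mono t r)
  then show ?case using monomial_carrier by blast
next
  case (add x y)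
  then show ?case using keys_add[of x y] unfolding free_alg_carrier_def by blast
qed

lemma level_carrier: "x \<in> lspan (pairs P Q) \<Longrightarrow> P \<subseteq> paths p \<Longrightarrow> Q \<subseteq> paths q \<Longrightarrow> x \<in> free_alg_carrier E"
  by (erule lspan_carrier) (auto simp: pairs_def)

lemma level_unital: "x \<in> lspan (pairs P Q) \<Longrightarrow> P \<subseteq> paths p \<Longrightarrow> Q \<subseteq> paths q \<Longrightarrow> x \<in> free_alg_unital"
  using level_carrier carrier_subset_unital by blast

lemma lspan_left:
  assumes "x \<in> lspan S" "a \<in> free_alg_unital" "\<And>t r. t \<in> S \<Longrightarrow> a * monomial r t \<in> lspan T"
  shows "a * x \<in> lspan T"
  using assms(1)
  by induction (auto simp: distrib_left intro: lspan.intros assms I_mult_left)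

lemma lspan_mult:
  assumes x: "x \<in> lspan S" and y: "y \<in> lspan T"
    and S: "\<And>t. t \<in> S \<Longrightarrow> \<exists>p q. t \<in> level p q" and T: "\<And>t. t \<in> T \<Longrightarrow> \<exists>p q. t \<in> level p q"
    and st: "\<And>s t r r'. s \<in> S \<Longrightarrow> t \<in> T \<Longrightarrow> monomial r s * monomial r' t \<in> lspan U"
  shows "x * y \<in> lspan U"
proof -
  have yC: "y \<in> free_alg_unital" using lspan_carrier[OF y T] carrier_subset_unital by blast
  have left: "monomial r s * y \<in> lspan U" if "s \<in> S" for r s
  proof -
    have "monomial r s \<in> free_alg_unital" using S[OF that] monomial_carrier carrier_subset_unital by blast
    then show ?thesis using lspan_left[OF y] st[OF that] by blast
  qed
  from x show ?thesis
    by induction (auto simp: distrib_right intro: lspan.intros yC left I_mult_right)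
qed

lemma level_iff: "(\<alpha>, v, \<beta>) \<in> level p q \<longleftrightarrow> path_to \<alpha> v \<and> path_to \<beta> v \<and> length \<alpha> = p \<and> length \<beta> = q"
  by (auto simp: pairs_def paths_def)

lemma coeff_word_Cons: "coeff_word r (g # gs) = W [g] * coeff_word r gs"
  by (simp add: coeff_word_mult)

lemma monomial_Cons:
  "W [g] * monomial r (\<alpha>, v, \<beta>) = coeff_word r ((g # real_path \<alpha> v) @ map Ghost (rev \<beta>))"
  by (simp add: monomial_def coeff_word_mult)

lemma scalar_monomial: "coeff_word s [] * monomial r t = monomial (s * r) t"
  by (simp add: monomial_def coeff_word_mult split: prod.split)

lemma ghosts_gens: "path_to \<beta> v \<Longrightarrow> set (map Ghost (rev \<beta>)) \<subseteq> lpa_gens E"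
  using path_to_arcs[of \<beta> v] by auto

section \<open>Products of spans of monomials\<close>

lemma vertex_monomial:
  assumes u: "u \<in> verts E" and t: "t \<in> level p q"
  shows "W [Vertex u] * monomial r t \<in> lspan (level p q)"
proof -
  obtain \<alpha> v \<beta> where t': "t = (\<alpha>, v, \<beta>)" "path_to \<alpha> v" "path_to \<beta> v"
    using t by (auto simp: pairs_def paths_def)
  show ?thesis
  proof (cases "u = path_src \<alpha> v")
    case True
    then have "W [Vertex u] * monomial r t \<approx> monomial r t"
      using cg_context[OF vertex_path[OF t'(2)], of "[]" "map Ghost (rev \<beta>)" r] ghosts_gens[OF t'(3)]
      by (simp add: t'(1) monomial_def coeff_word_mult)
    then show ?thesis using t lspan.mono lspan_cg by blast
  next
    case False
    then have "W [Vertex u] * monomial r t \<in> K"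
      using K_context[OF vertex_path_zero[OF t'(2) u], of "[]" "map Ghost (rev \<beta>)" r] ghosts_gens[OF t'(3)]
      by (simp add: t'(1) monomial_Cons)
    then show ?thesis by (rule lspan.ideal)
  qed
qed

lemma edge_monomial:
  assumes f: "f \<in> arcs E" and t: "t \<in> level p q"
  shows "W [Edge f] * monomial r t \<in> lspan (level (Suc p) q)"
proof -
  obtain \<alpha> v \<beta> where t': "t = (\<alpha>, v, \<beta>)" "path_to \<alpha> v" "path_to \<beta> v"
    using t by (auto simp: pairs_def paths_def)
  show ?thesis
  proof (cases "head E f = path_src \<alpha> v")
    case True
    then have "(f # \<alpha>, v, \<beta>) \<in> level (Suc p) q"
      using t f by (auto simp: t'(1) level_iff)
    moreover have "W [Edge f] * monomial r t = monomial r (f # \<alpha>, v, \<beta>)"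
      by (simp add: t'(1) monomial_Cons) (simp add: monomial_def real_path_simps)
    ultimately show ?thesis by (simp add: lspan.mono)
  next
    case False
    then have "W [Edge f] * monomial r t \<in> K"
      using K_context[OF edge_path_zero[OF t'(2) f], of "[]" "map Ghost (rev \<beta>)" r] ghosts_gens[OF t'(3)]
      by (simp add: t'(1) monomial_Cons)
    then show ?thesis by (rule lspan.ideal)
  qed
qed

text \<open>A ghost edge meets the first edge of \<alpha> if there is one, and otherwise joins the
  ghost part. Truncated subtraction covers both cases: \<open>q + (1 - p)\<close> exceeds
  \<open>q\<close> exactly when \<open>p = 0\<close>.\<close>

lemma ghost_monomial:
  assumes f: "f \<in> arcs E" and t: "t \<in> level p q"
  shows "W [Ghost f] * monomial r t \<in> lspan (level (p - 1) (q + (1 - p)))"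
proof -
  obtain \<alpha> v \<beta> where t': "t = (\<alpha>, v, \<beta>)" "path_to \<alpha> v" "path_to \<beta> v" "length \<alpha> = p" "length \<beta> = q"
    using t by (auto simp: pairs_def paths_def)
  note gh = ghosts_gens[OF t'(3)]
  show ?thesis
  proof (cases \<alpha>)
    case Nil
    show ?thesis
    proof (cases "v = tail E f")
      case True
      \<comment> \<open>A ghost edge put in front of the ghosts of \<beta> lengthens \<beta> at its
        end.\<close>
      have "(([], head E f, \<beta> @ [f])) \<in> level 0 (Suc q)"
        using t' f path_to_snoc[of \<beta> f] True by (simp add: level_iff)
      moreover have "W [Ghost f] * monomial r t \<approx> monomial r ([], head E f, \<beta> @ [f])"
        using cg_context[OF ghost_vertex[OF f], of "[]" "map Ghost (rev \<beta>)" r] gh True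
        by (simp add: t'(1) monomial_Cons) (simp add: monomial_def real_path_simps Nil)
      moreover have "p = 0" using Nil t' by simp
      ultimately show ?thesis using lspan_cg lspan.mono by fastforce
    next
      case False
      then have "W [Ghost f] * monomial r t \<in> K"
        using K_context[OF ghost_vertex_zero[OF f, of v], of "[]" "map Ghost (rev \<beta>)" r] gh path_to_verts t'
        by (simp add: t'(1) monomial_Cons Nil real_path_simps)
      then show ?thesis by (rule lspan.ideal)
    qed
  next
    case (Cons g \<alpha>')
    show ?thesis
    proof (cases "f = g")
      case True
      have "(\<alpha>', v, \<beta>) \<in> level (p - 1) (q + (1 - p))"
        using t' Cons by (auto simp: level_iff)
      moreover have "W [Ghost f] * monomial r t \<approx> monomial r (\<alpha>', v, \<beta>)"
        using cg_context[OF ghost_path, of g \<alpha>' v "[]" "map Ghost (rev \<beta>)" r] gh t' Cons True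
        by (simp add: t'(1) monomial_Cons) (simp add: monomial_def)
      ultimately show ?thesis using lspan_cg lspan.mono by blast
    next
      case False
      then have "W [Ghost f] * monomial r t \<in> K"
        using K_context[OF ghost_path_zero[of g \<alpha>' v f], of "[]" "map Ghost (rev \<beta>)" r] gh t' f Cons
        by (simp add: t'(1) monomial_Cons)
      then show ?thesis by (rule lspan.ideal)
    qed
  qed
qed

lemma ghosts_lspan:
  assumes "set fs \<subseteq> arcs E" "x \<in> lspan (level p q)"
  shows "W (map Ghost fs) * x \<in> lspan (level (p - length fs) (q + (length fs - p)))"
  using assms(1)
proof (induction fs)
  case Nil
  then show ?case using assms(2) by (simp add: coeff_word_def flip: zero_word_def)
next
  case (Cons f fs)
  let ?p = "p - length fs" and ?q = "q + (length fs - p)"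
  have "W (map Ghost (f # fs)) * x = W [Ghost f] * (W (map Ghost fs) * x)"
    by (simp add: coeff_word_mult flip: mult.assoc)
  also have "\<dots> \<in> lspan (level (?p - 1) (?q + (1 - ?p)))"
    using Cons by (intro lspan_left[OF Cons.IH] ghost_monomial coeff_word_unital) auto
  also have "?p - 1 = p - length (f # fs)" by simp
  also have "?q + (1 - ?p) = q + (length (f # fs) - p)" by simp
  finally show ?case .
qed

lemma edges_lspan:
  assumes "set fs \<subseteq> arcs E" "x \<in> lspan (level p q)"
  shows "W (map Edge fs) * x \<in> lspan (level (p + length fs) q)"
  using assms(1)
proof (induction fs)
  case Nil
  then show ?case using assms(2) by (simp add: coeff_word_def flip: zero_word_def)
next
  case (Cons f fs)
  have "W (map Edge (f # fs)) * x = W [Edge f] * (W (map Edge fs) * x)"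
    by (simp add: coeff_word_mult flip: mult.assoc)
  also have "\<dots> \<in> lspan (level (Suc (p + length fs)) q)"
    using Cons by (intro lspan_left[OF Cons.IH] edge_monomial coeff_word_unital) auto
  finally show ?case by simp
qed

text \<open>The \<open>q\<close> ghost edges of the left factor meet the \<open>p'\<close> edges of
  the right one; the shorter side is used up, so at least one of the truncated differences is
  zero.\<close>

lemma level_mult:
  assumes x: "x \<in> lspan (level p q)" and y: "y \<in> lspan (level p' q')"
  shows "x * y \<in> lspan (level (p + (p' - q)) (q' + (q - p')))"
proof (rule lspan_mult[OF x y])
  fix s t r r' assume s: "s \<in> level p q" and t: "t \<in> level p' q'"
  obtain \<alpha> v \<beta> where s': "s = (\<alpha>, v, \<beta>)" "path_to \<alpha> v" "path_to \<beta> v" "length \<alpha> = p" "length \<beta> = q"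
    using s by (auto simp: pairs_def paths_def)
  \<comment> \<open>The letters of \<open>s\<close> act on \<open>t\<close> from right to left:
    ghosts, vertex, edges, and finally the coefficient as a scalar.\<close>
  have "monomial r' t \<in> lspan (level p' q')" using t by (rule lspan.mono)
  from ghosts_lspan[of "rev \<beta>", OF _ this]
  have "W (map Ghost (rev \<beta>)) * monomial r' t \<in> lspan (level (p' - q) (q' + (q - p')))"
    using path_to_arcs[OF s'(3)] s'(5) by simp
  then have "W [Vertex v] * (W (map Ghost (rev \<beta>)) * monomial r' t) \<in> lspan (level (p' - q) (q' + (q - p')))"
    by (rule lspan_left) (use vertex_monomial path_to_verts s'(2) in \<open>auto intro: coeff_word_unital\<close>)
  from edges_lspan[of \<alpha>, OF _ this] s'
  have "W (map Edge \<alpha>) * (W [Vertex v] * (W (map Ghost (rev \<beta>)) * monomial r' t)) \<in> lspan (level (p + (p' - q)) (q' + (q - p')))"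
    using path_to_arcs by (simp add: add.commute)
  then have "coeff_word r [] * (W (map Edge \<alpha>) * (W [Vertex v] * (W (map Ghost (rev \<beta>)) * monomial r' t)))
      \<in> lspan (level (p + (p' - q)) (q' + (q - p')))"
    by (rule lspan_left) (auto intro: coeff_word_unital lspan.mono simp: scalar_monomial)
  then show "monomial r s * monomial r' t \<in> lspan (level (p + (p' - q)) (q' + (q - p')))"
    by (simp add: s'(1) monomial_def real_path_def coeff_word_mult flip: mult.assoc)
qed auto

text \<open>Letters are prepended one at a time; each maps the span of a level into the span of
  another and changes \<open>p - q\<close> by its own degree.\<close>

lemma word_in_level:
  assumes "gs \<noteq> []" "set gs \<subseteq> lpa_gens E"
  shows "\<exists>p q. int p - int q = word_deg (Word gs) \<and> coeff_word r gs \<in> lspan (level p q)"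
  using assms
proof (induction gs rule: list_nonempty_induct)
  case (single g)
  show ?case
  proof (cases g)
    case (Vertex v)
    have "([], v, []) \<in> level 0 0" using single by (simp add: level_iff Vertex)
    then have "monomial r ([], v, []) \<in> lspan (level 0 0)" by (rule lspan.mono)
    then show ?thesis
      by (intro exI[of _ 0]) (simp add: Vertex monomial_def real_path_simps word_deg_def)
  next
    case (Edge f)
    have "([f], head E f, []) \<in> level 1 0" using single by (simp add: level_iff Edge)
    then have "monomial r ([f], head E f, []) \<in> lspan (level 1 0)" by (rule lspan.mono)
    moreover have "coeff_word r [Edge f] \<approx> monomial r ([f], head E f, [])"
      using cg_context[OF lpa_cg(4)[THEN cg_sym], of f "[]" "[]" r] single
      by (simp add: Edge monomial_def real_path_simps)
    ultimately show ?thesis using lspan_cg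
      by (intro exI[of _ 1] exI[of _ 0]) (auto simp: Edge word_deg_def)
  next
    case (Ghost f)
    have "([], head E f, [f]) \<in> level 0 1" using single by (simp add: level_iff Ghost)
    then have "monomial r ([], head E f, [f]) \<in> lspan (level 0 1)" by (rule lspan.mono)
    moreover have "coeff_word r [Ghost f] \<approx> monomial r ([], head E f, [f])"
      using cg_context[OF lpa_cg(5)[THEN cg_sym], of f "[]" "[]" r] single
      by (simp add: Ghost monomial_def real_path_simps)
    ultimately show ?thesis using lspan_cg
      by (intro exI[of _ 0] exI[of _ 1]) (auto simp: Ghost word_deg_def)
  qed
next
  case (cons g gs)
  then obtain p q where pq: "int p - int q = word_deg (Word gs)" "coeff_word r gs \<in> lspan (level p q)"
    by auto
  have g: "W [g] \<in> free_alg_unital" using cons by (intro coeff_word_unital) auto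
  have eq: "coeff_word r (g # gs) = W [g] * coeff_word r gs" by (rule coeff_word_Cons)
  show ?case
  proof (cases g)
    case (Vertex v)
    then have "coeff_word r (g # gs) \<in> lspan (level p q)"
      unfolding eq using cons by (intro lspan_left[OF pq(2) g]) (auto intro: vertex_monomial)
    then show ?thesis using pq Vertex by (auto simp: word_deg_def)
  next
    case (Edge f)
    then have "coeff_word r (g # gs) \<in> lspan (level (Suc p) q)"
      unfolding eq using cons by (intro lspan_left[OF pq(2) g]) (auto intro: edge_monomial)
    then show ?thesis using pq Edge by (intro exI[of _ "Suc p"] exI[of _ q]) (auto simp: word_deg_def)
  next
    case (Ghost f)
    have "coeff_word r (g # gs) \<in> lspan (level (p - 1) (q + (1 - p)))"
      unfolding eq unfolding Ghost by (intro lspan_left[OF pq(2)] ghost_monomial coeff_word_unital) (use cons Ghost in \<open>auto simp del: One_nat_def\<close>)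
    then show ?thesis using pq Ghost
      by (intro exI[of _ "p - 1"] exI[of _ "q + (1 - p)"]) (auto simp: word_deg_def)
  qed
qed

subsection \<open>Generalized inverses of homogeneous elements\<close>

text \<open>For equal lengths, cancellation goes on edge by edge or stops with zero at the first
  mismatch. The leading vertex \<open>v\<close> decides the final comparison of end
  vertices.\<close>

lemma ghosts_edges:
  assumes "length \<beta> = length \<gamma>" "path_to \<beta> v" "path_to \<gamma> w"
  shows "W (Vertex v # map Ghost (rev \<beta>) @ real_path \<gamma> w) \<approx>
    (if \<beta> = \<gamma> \<and> v = w then W [Vertex v] else 0)"
  using assms
proof (induction \<beta> \<gamma> rule: list_induct2)
  case Nil
  then show ?case
    using lpa_cg(1)[of v] lpa_cg(2)[of v w] by (auto simp: real_path_simps cg_def)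
next
  case (Cons f \<beta> g \<gamma>)
  have gens: "set (Vertex v # map Ghost (rev \<beta>)) \<subseteq> lpa_gens E"
    using Cons.prems ghosts_gens[of \<beta> v] path_to_verts[of \<beta> v] by auto
  show ?case
  proof (cases "f = g")
    case True
    have "W (Vertex v # map Ghost (rev (f # \<beta>)) @ real_path (g # \<gamma>) w) \<approx>
        W (Vertex v # map Ghost (rev \<beta>) @ real_path \<gamma> w)"
      using cg_context[OF ghost_path, of g \<gamma> w "Vertex v # map Ghost (rev \<beta>)" "[]" 1] gens Cons.prems True
      by simp
    also have "\<dots> \<approx> (if \<beta> = \<gamma> \<and> v = w then W [Vertex v] else 0)"
      using Cons.IH Cons.prems by simp
    finally show ?thesis using True by simp
  next
    case False
    then show ?thesis
      using K_context[OF ghost_path_zero, of g \<gamma> w f "Vertex v # map Ghost (rev \<beta>)" "[]" 1] gens Cons.prems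
      by (simp add: cg_def)
  qed
qed

text \<open>The multiplication rule of matrix units, with rows and columns indexed by paths.\<close>

lemma monomial_mult:
  assumes "path_to \<alpha> v" "path_to \<beta> v" "path_to \<gamma> w" "path_to \<delta> w" "length \<beta> = length \<gamma>"
  shows "monomial r (\<alpha>, v, \<beta>) * monomial s (\<gamma>, w, \<delta>) \<approx>
    (if \<beta> = \<gamma> \<and> v = w then monomial (r * s) (\<alpha>, v, \<delta>) else 0)"
proof -
  have "coeff_word (r * s) (map Edge \<alpha>) * W (Vertex v # map Ghost (rev \<beta>) @ real_path \<gamma> w) * W (map Ghost (rev \<delta>))
    \<approx> coeff_word (r * s) (map Edge \<alpha>) * (if \<beta> = \<gamma> \<and> v = w then W [Vertex v] else 0) * W (map Ghost (rev \<delta>))"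
    using assms ghosts_gens[of \<delta> w] path_to_arcs[of \<alpha> v]
    by (intro cg_left cg_right ghosts_edges coeff_word_unital) auto
  note * = this
  show ?thesis
  proof (cases "\<beta> = \<gamma> \<and> v = w")
    case True
    show ?thesis using * unfolding if_P[OF True]
      using True by (simp add: monomial_def coeff_word_mult real_path_def)
  next
    case False
    show ?thesis using * unfolding if_not_P[OF False]
      by (simp add: monomial_def coeff_word_mult real_path_def)
  qed
qed

lemma pairs_level:
  assumes "t \<in> pairs P Q" "P \<subseteq> paths p" "Q \<subseteq> paths q"
  shows "t \<in> level p q"
  using assms by (auto simp: pairs_def)

text \<open>Only equal inner paths contribute, so disjoint inner index sets leave a product in
  \<open>K\<close>, the span of the empty set.\<close>

lemma pairs_mult:
  assumes x: "x \<in> lspan (pairs P Q)" and y: "y \<in> lspan (pairs Q' P')"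
    and sub: "P \<subseteq> paths p" "Q \<subseteq> paths q" "Q' \<subseteq> paths q" "P' \<subseteq> paths p'"
  shows "x * y \<in> lspan (if Q \<inter> Q' = {} then {} else pairs P P')"
proof (rule lspan_mult[OF x y])
  fix s t r r' assume st: "s \<in> pairs P Q" "t \<in> pairs Q' P'"
  then obtain \<alpha> v \<beta> \<gamma> w \<delta> where t: "s = (\<alpha>, v, \<beta>)" "t = (\<gamma>, w, \<delta>)"
    "(\<alpha>, v) \<in> P" "(\<beta>, v) \<in> Q" "(\<gamma>, w) \<in> Q'" "(\<delta>, w) \<in> P'"
    by (auto simp: pairs_def)
  have "(\<alpha>, v) \<in> paths p" "(\<beta>, v) \<in> paths q" "(\<gamma>, w) \<in> paths q" "(\<delta>, w) \<in> paths p'"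
    using subsetD[OF sub(1) t(3)] subsetD[OF sub(2) t(4)] subsetD[OF sub(3) t(5)] subsetD[OF sub(4) t(6)] .
  then have "monomial r s * monomial r' t \<approx>
    (if \<beta> = \<gamma> \<and> v = w then monomial (r * r') (\<alpha>, v, \<delta>) else 0)"
    unfolding t(1,2) by (intro monomial_mult) (simp_all add: paths_def)
  moreover have "(if \<beta> = \<gamma> \<and> v = w then monomial (r * r') (\<alpha>, v, \<delta>) else 0)
    \<in> lspan (if Q \<inter> Q' = {} then {} else pairs P P')"
  proof (cases "\<beta> = \<gamma> \<and> v = w")
    case True
    then have "Q \<inter> Q' \<noteq> {}" "(\<alpha>, v, \<delta>) \<in> pairs P P'" using t by (auto simp: pairs_def)
    then show ?thesis using True by (simp add: lspan.mono)
  next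
    case False
    show ?thesis unfolding if_not_P[OF False] by (rule lspan.ideal[OF I_0])
  qed
  ultimately show "monomial r s * monomial r' t \<in> lspan (if Q \<inter> Q' = {} then {} else pairs P P')"
    by (rule lspan_cg)
qed (use pairs_level sub in blast)+

lemma pairs_mult_same:
  assumes "x \<in> lspan (pairs P Q)" "y \<in> lspan (pairs Q' P')"
    "P \<subseteq> paths p" "Q \<subseteq> paths q" "Q' \<subseteq> paths q" "P' \<subseteq> paths p'"
  shows "x * y \<in> lspan (pairs P P')"
  using pairs_mult[OF assms] lspan_mono[of "{}" "pairs P P'"] by (auto split: if_splits)

lemma pairs_mult_disjoint:
  assumes "x \<in> lspan (pairs P Q)" "y \<in> lspan (pairs Q' P')"
    "P \<subseteq> paths p" "Q \<subseteq> paths q" "Q' \<subseteq> paths q" "P' \<subseteq> paths p'" "Q \<inter> Q' = {}"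
  shows "x * y \<in> K"
  using pairs_mult[OF assms(1-6)] assms(7) by (simp add: lspan_empty)

lemma pairs_empty [simp]: "pairs {} Q = {}" "pairs P {} = {}"
  by (auto simp: pairs_def)

lemma pairs_subset: "P \<subseteq> P' \<Longrightarrow> Q \<subseteq> Q' \<Longrightarrow> x \<in> lspan (pairs P Q) \<Longrightarrow> x \<in> lspan (pairs P' Q')"
  using lspan_mono[of "pairs P Q" "pairs P' Q'"] by (auto simp: pairs_def)

lemma pairs_mccoy:
  assumes P: "P \<subseteq> paths p" and Q: "Q \<subseteq> paths q" and x: "x \<in> lspan (pairs P Q)"
    and y: "y \<in> lspan (pairs Q P)"
    and z: "\<exists>z\<in>lspan (pairs Q P). (x - x * y * x) * z * (x - x * y * x) \<approx> x - x * y * x"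
  shows "\<exists>z\<in>lspan (pairs Q P). x * z * x \<approx> x"
proof -
  let ?Y = "lspan (pairs Q P)"
  obtain z where z: "z \<in> ?Y" "(x - x * y * x) * z * (x - x * y * x) \<approx> x - x * y * x"
    using assms(5) by blast
  have closed: "u * x * v \<in> ?Y" if "u \<in> ?Y" "v \<in> ?Y" for u v
    by (rule pairs_mult_same[OF pairs_mult_same[OF that(1) x Q P P Q] that(2) Q Q Q P])
  have "?Y \<subseteq> free_alg_unital" using level_unital[OF _ Q P] by blast
  from regular_mccoy[OF level_unital[OF x P Q] y z(1) this lspan.add lspan_diff closed z(2)]
  show ?thesis .
qed

text \<open>
  The additive span of \<open>\<alpha> v \<beta>\<^sup>*\<close> with \<open>\<alpha>\<close> and \<open>\<beta>\<close> from finite sets of paths of fixed lengths is a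
  ring of rectangular matrices over the coefficients. Splitting off one row, and then one
  column, the difference \<open>x - x y x\<close> lives in that row or column when \<open>y\<close> is a generalized inverse
  of the remaining part of \<open>x\<close>.
\<close>

lemma single_entry_regular:
  assumes regular: "\<forall>r::'r. \<exists>s. r = r * s * r"
    and a: "a \<in> paths p" and b: "b \<in> paths q" and x: "x \<in> lspan (pairs {a} {b})"
  shows "\<exists>y\<in>lspan (pairs {b} {a}). x * y * x \<approx> x"
proof (cases "snd a = snd b")
  case False
  then have "pairs {a} {b} = {}" by (auto simp: pairs_def)
  then have "x \<in> K" using x lspan_empty by simp
  then have "x * 0 * x \<approx> x" using I_uminus by (simp add: cg_def)
  then show ?thesis using lspan.ideal[OF I_0] by blast
next
  case True
  then obtain \<alpha> \<beta> v where ab: "a = (\<alpha>, v)" "b = (\<beta>, v)" by (metis prod.collapse)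
  have paths: "path_to \<alpha> v" "path_to \<beta> v" using a b by (auto simp: ab paths_def)
  have p: "pairs {a} {b} = {(\<alpha>, v, \<beta>)}" by (auto simp: pairs_def ab)
  have "\<exists>r. x \<approx> monomial r (\<alpha>, v, \<beta>)"
    using x unfolding p
  proof induction
    case (ideal x)
    then show ?case by (intro exI[of _ 0]) (simp add: monomial_def cg_def)
  next
    case (add x y)
    then obtain r s where "x \<approx> monomial r (\<alpha>, v, \<beta>)" "y \<approx> monomial s (\<alpha>, v, \<beta>)" by blast
    then have "x + y \<approx> monomial r (\<alpha>, v, \<beta>) + monomial s (\<alpha>, v, \<beta>)" by (rule cg_add)
    then show ?case by (intro exI[of _ "r + s"]) (simp add: monomial_def coeff_word_add)
  next
    case (mono t s)
    then show ?case by (intro exI[of _ s]) simp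
  qed
  then obtain r where r: "x \<approx> monomial r (\<alpha>, v, \<beta>)" by blast
  obtain s where s: "r = r * s * r" using regular by blast
  let ?x = "monomial r (\<alpha>, v, \<beta>)" and ?y = "monomial s (\<beta>, v, \<alpha>)"
  have "(\<beta>, v, \<alpha>) \<in> pairs {b} {a}" by (simp add: pairs_def ab)
  then have y: "?y \<in> lspan (pairs {b} {a})" by (rule lspan.mono)
  have yC: "?y \<in> free_alg_unital" using level_unital[OF y, of q p] a b by simp
  have xC: "x \<in> free_alg_unital" "?x \<in> free_alg_unital"
    using level_unital[OF x, of p q] level_unital[OF lspan.mono, of "(\<alpha>, v, \<beta>)" "{a}" "{b}" p q r] a b by (auto simp: p)
  have "x * ?y * x \<approx> ?x * ?y * x" using r yC xC by (intro cg_right)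
  also have "\<dots> \<approx> ?x * ?y * ?x" using r yC xC C_mult by (intro cg_left) auto
  also have "\<dots> \<approx> monomial (r * s) (\<alpha>, v, \<alpha>) * ?x"
    using monomial_mult[of \<alpha> v \<beta> \<beta> v \<alpha> r s] paths xC by (intro cg_right) auto
  also have "\<dots> \<approx> monomial (r * s * r) (\<alpha>, v, \<beta>)"
    using monomial_mult[of \<alpha> v \<alpha> \<alpha> v \<beta> "r * s" r] paths by simp
  also have "\<dots> = ?x" using s by simp
  also have "?x \<approx> x" using r by (rule cg_sym)
  finally show ?thesis using y by blast
qed

lemma pairs_insert:
  "pairs (insert a P) Q = pairs {a} Q \<union> pairs P Q" "pairs P (insert b Q) = pairs P {b} \<union> pairs P Q"
  by (auto simp: pairs_def)

lemma single_column_regular: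
  assumes regular: "\<forall>r::'r. \<exists>s. r = r * s * r"
    and "finite P" "P \<subseteq> paths p" "b \<in> paths q" "x \<in> lspan (pairs P {b})"
  shows "\<exists>y\<in>lspan (pairs {b} P). x * y * x \<approx> x"
  using assms(2-)
proof (induction P arbitrary: x rule: finite_induct)
  case empty
  then have "x \<in> K" by (simp add: lspan_empty)
  then have "x * 0 * x \<approx> x" using I_uminus by (simp add: cg_def)
  then show ?case using lspan.ideal[OF I_0] by blast
next
  case (insert a P)
  have sub: "{a} \<subseteq> paths p" "P \<subseteq> paths p" "{b} \<subseteq> paths q" "insert a P \<subseteq> paths p" using insert.prems by auto
  obtain x1 x2 where x12: "x1 \<in> lspan (pairs P {b})" "x2 \<in> lspan (pairs {a} {b})" "x = x2 + x1"
    using lspan_Un[OF insert.prems(3)[unfolded pairs_insert(1)[of a P]]] by blast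
  obtain y where y: "y \<in> lspan (pairs {b} P)" "x1 * y * x1 \<approx> x1"
    using insert.IH[OF sub(2) insert.prems(2) x12(1)] by blast
  have y': "y \<in> lspan (pairs {b} (insert a P))"
    by (rule pairs_subset[OF _ _ y(1)]) auto
  \<comment> \<open>The columns of \<open>y\<close> are indexed by \<open>P\<close>, while
    \<open>x2\<close> has only the row \<open>a\<close>, which is not in \<open>P\<close>.\<close>
  have "y * x2 \<in> K" by (rule pairs_mult_disjoint[OF y(1) x12(2)]) (use sub insert.hyps in auto)
  then have "x * (y * x2) \<in> K" using level_unital[OF insert.prems(3) sub(4,3)] by (rule I_mult_left[rotated])
  moreover have "x1 - x1 * y * x1 \<in> K" using y(2) cg_sym unfolding cg_def by blast
  moreover have "x2 * y * x1 \<in> lspan (pairs {a} {b})"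
    by (rule pairs_mult_same[OF pairs_mult_same[OF x12(2) y(1) sub(1,3,3,2)] x12(1) sub(1,2,2,3)])
  \<comment> \<open>Modulo \<open>K\<close> only the middle bracket survives, and it is confined to
    the row \<open>a\<close>.\<close>
  moreover have "x - x * y * x = (x1 - x1 * y * x1) + (x2 - x2 * y * x1) - x * (y * x2)"
    by (simp add: x12(3) algebra_simps)
  ultimately have "x - x * y * x \<in> lspan (pairs {a} {b})"
    using lspan_diff[OF lspan.add[OF lspan.ideal lspan_diff[OF x12(2)]] lspan.ideal] by simp
  then obtain z where z: "z \<in> lspan (pairs {b} {a})" "(x - x * y * x) * z * (x - x * y * x) \<approx> x - x * y * x"
    using single_entry_regular[OF regular, of a p b q] sub by blast
  have "z \<in> lspan (pairs {b} (insert a P))"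
    by (rule pairs_subset[OF _ _ z(1)]) auto
  then show ?case using z(2) pairs_mccoy[OF sub(4,3) insert.prems(3) y'] by blast
qed

lemma finite_pairs_regular:
  assumes regular: "\<forall>r::'r. \<exists>s. r = r * s * r"
    and "finite Q" "finite P" "P \<subseteq> paths p" "Q \<subseteq> paths q" "x \<in> lspan (pairs P Q)"
  shows "\<exists>y\<in>lspan (pairs Q P). x * y * x \<approx> x"
  using assms(2-)
proof (induction Q arbitrary: x rule: finite_induct)
  case empty
  then have "x \<in> K" by (simp add: lspan_empty)
  then have "x * 0 * x \<approx> x" using I_uminus by (simp add: cg_def)
  then show ?case using lspan.ideal[OF I_0] by blast
next
  case (insert b Q)
  have sub: "{b} \<subseteq> paths q" "Q \<subseteq> paths q" "P \<subseteq> paths p" "insert b Q \<subseteq> paths q" using insert.prems by auto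
  obtain x1 x2 where x12: "x1 \<in> lspan (pairs P Q)" "x2 \<in> lspan (pairs P {b})" "x = x2 + x1"
    using lspan_Un[OF insert.prems(4)[unfolded pairs_insert(2)[of P b Q]]] by blast
  obtain y where y: "y \<in> lspan (pairs Q P)" "x1 * y * x1 \<approx> x1"
    using insert.IH[OF insert.prems(1) sub(3,2) x12(1)] by blast
  have y': "y \<in> lspan (pairs (insert b Q) P)"
    by (rule pairs_subset[OF _ _ y(1)]) auto
  \<comment> \<open>The transposed situation: \<open>x2\<close> has only the column
    \<open>b\<close>, which is not among the rows \<open>Q\<close> of \<open>y\<close>.\<close>
  have "x2 * y \<in> K" by (rule pairs_mult_disjoint[OF x12(2) y(1)]) (use sub insert.hyps in auto)
  then have "(x2 * y) * x \<in> K" using level_unital[OF insert.prems(4) sub(3,4)] by (rule I_mult_right)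
  moreover have "x1 - x1 * y * x1 \<in> K" using y(2) cg_sym unfolding cg_def by blast
  moreover have "x1 * y * x2 \<in> lspan (pairs P {b})"
    by (rule pairs_mult_same[OF pairs_mult_same[OF x12(1) y(1) sub(3,2,2,3)] x12(2) sub(3,3,3,1)])
  moreover have "x - x * y * x = (x1 - x1 * y * x1) + (x2 - x1 * y * x2) - (x2 * y) * x"
    by (simp add: x12(3) algebra_simps)
  ultimately have "x - x * y * x \<in> lspan (pairs P {b})"
    using lspan_diff[OF lspan.add[OF lspan.ideal lspan_diff[OF x12(2)]] lspan.ideal] by simp
  then obtain z where z: "z \<in> lspan (pairs {b} P)" "(x - x * y * x) * z * (x - x * y * x) \<approx> x - x * y * x"
    using single_column_regular[OF regular, of P p b q] sub insert.prems by blast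
  have "z \<in> lspan (pairs (insert b Q) P)"
    by (rule pairs_subset[OF _ _ z(1)]) auto
  then show ?case using z(2) pairs_mccoy[OF sub(3,4) insert.prems(4) y'] by blast
qed

text \<open>There may be infinitely many paths of a given length, but one element of the span
  involves finitely many. This supplies the index sets for the matrix argument.\<close>

lemma finite_support:
  assumes "x \<in> lspan (level p q)"
  shows "\<exists>P Q. finite P \<and> finite Q \<and> P \<subseteq> paths p \<and> Q \<subseteq> paths q \<and> x \<in> lspan (pairs P Q)"
  using assms
proof (induction rule: lspan.induct)
  case (ideal x)
  then show ?case by (intro exI[of _ "{}"]) (simp add: lspan.ideal)
next
  case (mono t r)
  then obtain \<alpha> v \<beta> where t: "t = (\<alpha>, v, \<beta>)" "(\<alpha>, v) \<in> paths p" "(\<beta>, v) \<in> paths q"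
    by (auto simp: pairs_def)
  have "monomial r t \<in> lspan (pairs {(\<alpha>, v)} {(\<beta>, v)})"
    by (rule lspan.mono) (simp add: t pairs_def)
  then show ?case using t by (intro exI[of _ "{(\<alpha>, v)}"] exI[of _ "{(\<beta>, v)}"]) simp
next
  case (add x y)
  then obtain P Q P' Q' where
    "finite P \<and> finite Q \<and> P \<subseteq> paths p \<and> Q \<subseteq> paths q \<and> x \<in> lspan (pairs P Q)"
    "finite P' \<and> finite Q' \<and> P' \<subseteq> paths p \<and> Q' \<subseteq> paths q \<and> y \<in> lspan (pairs P' Q')" by blast
  then show ?case
    using pairs_subset[of P "P \<union> P'" Q "Q \<union> Q'" x] pairs_subset[of P' "P \<union> P'" Q' "Q \<union> Q'" y]
    by (intro exI[of _ "P \<union> P'"] exI[of _ "Q \<union> Q'"]) (simp add: lspan.add)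
qed

lemma level_regular:
  assumes regular: "\<forall>r::'r. \<exists>s. r = r * s * r" and x: "x \<in> lspan (level p q)"
  shows "\<exists>y\<in>lspan (level q p). x * y * x \<approx> x"
proof -
  obtain P Q where PQ: "finite P" "finite Q" "P \<subseteq> paths p" "Q \<subseteq> paths q" "x \<in> lspan (pairs P Q)"
    using finite_support[OF x] by blast
  then show ?thesis
    using finite_pairs_regular[OF regular, of Q P p q x] pairs_subset[of Q "paths q" P "paths p"] by blast
qed

text \<open>All these levels have degree \<open>p - q\<close>; \<open>i\<close> is a common excess
  length of both paths.\<close>

definition levels :: "nat \<Rightarrow> nat \<Rightarrow> nat set \<Rightarrow> ('e list \<times> 'v \<times> 'e list) set" where
  "levels p q A = (\<Union>i\<in>A. level (p + i) (q + i))"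

lemma levels_mono: "A \<subseteq> B \<Longrightarrow> x \<in> lspan (levels p q A) \<Longrightarrow> x \<in> lspan (levels p q B)"
proof -
  assume "A \<subseteq> B" and x: "x \<in> lspan (levels p q A)"
  then have "levels p q A \<subseteq> levels p q B" unfolding levels_def by (intro UN_mono) auto
  from subsetD[OF lspan_mono[OF this] x] show ?thesis .
qed

lemma levels_carrier: "x \<in> lspan (levels p q A) \<Longrightarrow> x \<in> free_alg_carrier E"
  by (erule lspan_carrier) (unfold levels_def, blast)

text \<open>By \<open>level_mult\<close> the excess of a product is the larger of the two excesses,
  so the highest level absorbs the lower ones.\<close>

lemma levels_mult:
  assumes x: "x \<in> lspan (levels p q A)" and y: "y \<in> lspan (levels q r B)"
    and D: "\<And>i j. i \<in> A \<Longrightarrow> j \<in> B \<Longrightarrow> max i j \<in> D"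
  shows "x * y \<in> lspan (levels p r D)"
proof (rule lspan_mult[OF x y])
  fix s t c d assume "s \<in> levels p q A" "t \<in> levels q r B"
  then obtain i j where ij: "i \<in> A" "j \<in> B" "s \<in> level (p + i) (q + i)" "t \<in> level (q + j) (r + j)"
    by (auto simp: levels_def)
  have "monomial c s * monomial d t \<in> lspan (level (p + i + (q + j - (q + i))) (r + j + (q + i - (q + j))))"
    using ij by (intro level_mult lspan.mono)
  also have "p + i + (q + j - (q + i)) = p + max i j" by simp
  also have "r + j + (q + i - (q + j)) = r + max i j" by simp
  finally have prod: "monomial c s * monomial d t \<in> lspan (level (p + max i j) (r + max i j))" .
  have "level (p + max i j) (r + max i j) \<subseteq> levels p r D"
    unfolding levels_def using D[OF ij(1,2)] by (intro UN_upper)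
  from subsetD[OF lspan_mono[OF this] prod]
  show "monomial c s * monomial d t \<in> lspan (levels p r D)" .
qed (unfold levels_def, blast+)

text \<open>
  Multiplying by elements of the highest level stays in that level, so the
  difference \<open>x - x y x\<close> lies there when \<open>y\<close> is a generalized inverse of the lower part of \<open>x\<close>.
\<close>

lemma levels_regular:
  assumes regular: "\<forall>r::'r. \<exists>s. r = r * s * r" and "x \<in> lspan (levels p q {..<k})"
  shows "\<exists>y\<in>lspan (levels q p {..<k}). x * y * x \<approx> x"
  using assms(2)
proof (induction k arbitrary: x)
  case 0
  then have "x \<in> K" by (simp add: levels_def lspan_empty)
  then have "x * 0 * x \<approx> x" using I_uminus by (simp add: cg_def)
  then show ?case using lspan.ideal[OF I_0] by blast
next
  case (Suc k)
  have "levels p q {..<Suc k} = levels p q {..<k} \<union> levels p q {k}"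
    by (auto simp: levels_def lessThan_Suc)
  then obtain x1 x2 where x12: "x1 \<in> lspan (levels p q {..<k})" "x2 \<in> lspan (levels p q {k})" "x = x1 + x2"
    using lspan_Un[of x] Suc.prems by metis
  obtain y where y: "y \<in> lspan (levels q p {..<k})" "x1 * y * x1 \<approx> x1"
    using Suc.IH[OF x12(1)] by blast
  have x2_left: "x2 * y * u \<in> lspan (levels p q {k})" if "u \<in> lspan (levels p q {..<Suc k})" for u
    by (rule levels_mult[OF levels_mult[OF x12(2) y(1), of "{k}"] that]) auto
  have x1_left: "x1 * y * x2 \<in> lspan (levels p q {k})"
    by (rule levels_mult[OF levels_mult[OF x12(1) y(1), of "{..<k}"] x12(2)]) auto
  have "x1 - x1 * y * x1 \<in> K" using y(2) cg_sym unfolding cg_def by blast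
  moreover have "x - x * y * x = (x1 - x1 * y * x1) + (x2 - x2 * y * x) - x1 * y * x2"
    by (simp add: x12(3) algebra_simps)
  ultimately have "x - x * y * x \<in> lspan (levels p q {k})"
    using lspan_diff[OF lspan.add[OF lspan.ideal lspan_diff[OF x12(2) x2_left[OF Suc.prems]]] x1_left] by simp
  then have "\<exists>z\<in>lspan (levels q p {k}). (x - x * y * x) * z * (x - x * y * x) \<approx> x - x * y * x"
    using level_regular[OF regular] by (simp add: levels_def)
  then obtain z where z: "z \<in> lspan (levels q p {k})" "(x - x * y * x) * z * (x - x * y * x) \<approx> x - x * y * x"
    by blast
  let ?Y = "lspan (levels q p {..<Suc k})"
  have closed: "u * x * v \<in> ?Y" if "u \<in> ?Y" "v \<in> ?Y" for u v
    by (rule levels_mult[OF levels_mult[OF that(1) Suc.prems, of "{..<Suc k}"] that(2)]) auto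
  have mem: "y \<in> ?Y" "z \<in> ?Y"
    using levels_mono[OF _ y(1), of "{..<Suc k}"] levels_mono[OF _ z(1), of "{..<Suc k}"] by auto
  have "x \<in> free_alg_unital" "?Y \<subseteq> free_alg_unital"
    using levels_carrier[OF Suc.prems] levels_carrier carrier_subset_unital by blast+
  then show ?case
    by (rule regular_mccoy[OF _ mem _ _ _ _ z(2)]) (auto intro: lspan.add lspan_diff closed)
qed

text \<open>\<open>nat n\<close> and \<open>nat (- n)\<close> are the shortest lengths with
  difference \<open>n\<close>, and every other such pair arises by a common excess. Finitely many
  words need finitely many levels.\<close>

lemma homogeneous_in_levels:
  assumes "x \<in> free_alg_carrier E"
  shows "\<exists>k. hcomp n x \<in> lspan (levels (nat n) (nat (- n)) {..<k})"
proof -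
  let ?L = "\<lambda>k. lspan (levels (nat n) (nat (- n)) {..<k})"
  have word: "\<exists>k. Poly_Mapping.single w (Poly_Mapping.lookup x w) \<in> ?L k"
    if w: "w \<in> Poly_Mapping.keys x" "word_deg w = n" for w
  proof -
    obtain gs where gs: "w = Word gs" by (cases w)
    have "letters w \<noteq> [] \<and> set (letters w) \<subseteq> lpa_gens E"
      using assms w(1) by (simp add: free_alg_carrier_def)
    then have "gs \<noteq> []" "set gs \<subseteq> lpa_gens E"
      by (simp_all add: gs)
    note word = word_in_level[OF this, of "Poly_Mapping.lookup x w"]
    then obtain p q where pq: "int p - int q = n" "coeff_word (Poly_Mapping.lookup x w) gs \<in> lspan (level p q)"
      using word w(2) unfolding gs by blast
    define m where "m = min p q"
    have m: "p = nat n + m" "q = nat (- n) + m" unfolding m_def using pq(1) by auto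
    have "level (nat n + m) (nat (- n) + m) \<subseteq> levels (nat n) (nat (- n)) {..<Suc m}"
      unfolding levels_def by (rule UN_upper) simp
    from subsetD[OF lspan_mono[OF this] pq(2)[unfolded m]] show ?thesis
      unfolding coeff_word_def gs by blast
  qed
  have sum: "\<exists>k. sum f A \<in> ?L k" if "finite A" "\<And>w. w \<in> A \<Longrightarrow> \<exists>k. f w \<in> ?L k"
    for A :: "('v, 'e) lpa_gen word set" and f
    using that
  proof (induction A rule: finite_induct)
    case empty
    then show ?case using lspan.ideal[OF I_0] by auto
  next
    case (insert w A)
    then obtain k l where kl: "f w \<in> ?L k" "sum f A \<in> ?L l" by blast
    have "f w \<in> ?L (max k l)" "sum f A \<in> ?L (max k l)"
      using levels_mono[OF _ kl(1), of "{..<max k l}"] levels_mono[OF _ kl(2), of "{..<max k l}"] by auto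
    then have "f w + sum f A \<in> ?L (max k l)" by (rule lspan.add)
    then show ?case using insert.hyps by auto
  qed
  show ?thesis unfolding hcomp_def using word by (intro sum) auto
qed

lemma lpa_homogeneous_regular:
  assumes "\<forall>r::'r. \<exists>s. r = r * s * r" "x \<in> free_alg_carrier E"
  shows "\<exists>y\<in>free_alg_carrier E. hcomp n x * y * hcomp n x - hcomp n x \<in> K"
proof -
  obtain k where "hcomp n x \<in> lspan (levels (nat n) (nat (- n)) {..<k})"
    using homogeneous_in_levels[OF assms(2)] by blast
  from levels_regular[OF assms(1) this] show ?thesis
    using levels_carrier unfolding cg_def by blast
qed

subsection \<open>Passage to the quotient\<close>

text \<open>The cosets of the quotient, written with the class operations so that representatives
  can be compared by congruence.\<close>

definition coset :: "('v, 'e, 'r) free_alg \<Rightarrow> ('v, 'e, 'r) free_alg set" where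
  "coset a = {k + a |k. k \<in> K}"

lemma coset_eq: "a_r_coset (free_alg_ring E) K a = coset a"
  by (auto simp: a_r_coset_def r_coset_def coset_def free_alg_ring_def)

lemma coset_eq_iff: "coset a = coset b \<longleftrightarrow> a \<approx> b"
proof
  assume "coset a = coset b"
  moreover have "a \<in> coset a" unfolding coset_def using I_0 by force
  ultimately show "a \<approx> b" by (auto simp: coset_def cg_def)
next
  have "coset a \<subseteq> coset b" if "a \<approx> b" for a b
  proof
    fix x assume "x \<in> coset a"
    then obtain k where "k \<in> K" "x = k + a" by (auto simp: coset_def)
    then have "k + (a - b) \<in> K" "x = (k + (a - b)) + b"
      using I_add that by (auto simp: cg_def)
    then show "x \<in> coset b" unfolding coset_def by blast
  qed
  then show "a \<approx> b \<Longrightarrow> coset a = coset b" using cg_sym by blast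
qed

lemma mem_coset: "x \<in> coset a \<longleftrightarrow> x \<approx> a"
proof
  assume "x \<approx> a"
  then show "x \<in> coset a" unfolding coset_def cg_def
    by (intro CollectI exI[of _ "x - a"]) simp
qed (auto simp: coset_def cg_def)

section \<open>Operations of the quotient on representatives\<close>

abbreviation L where "L \<equiv> leavitt_path_algebra TYPE('r) E"

lemma lpa_carrier: "carrier L = coset ` free_alg_carrier E"
  by (auto simp: leavitt_path_algebra_def FactRing_def A_RCOSETS_def RCOSETS_def r_coset_def
      coset_def free_alg_ring_def image_iff)

lemma lpa_zero: "\<zero>\<^bsub>L\<^esub> = coset 0"
  by (simp add: leavitt_path_algebra_def FactRing_def coset_def)

lemma lpa_add: "coset a \<oplus>\<^bsub>L\<^esub> coset b = coset (a + b)"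
proof -
  have "coset a \<oplus>\<^bsub>L\<^esub> coset b = {x + y |x y. x \<in> coset a \<and> y \<in> coset b}"
    by (auto simp: leavitt_path_algebra_def FactRing_def set_add_def set_mult_def free_alg_ring_def)
  also have "\<dots> = coset (a + b)"
  proof (intro Set.set_eqI iffI)
    fix z assume "z \<in> {x + y |x y. x \<in> coset a \<and> y \<in> coset b}"
    then show "z \<in> coset (a + b)" using cg_add by (auto simp: mem_coset)
  next
    fix z assume "z \<in> coset (a + b)"
    then have "z - b \<in> coset a" by (simp add: mem_coset cg_def algebra_simps)
    moreover have "b \<in> coset b" "z = (z - b) + b" by (simp_all add: mem_coset)
    ultimately show "z \<in> {x + y |x y. x \<in> coset a \<and> y \<in> coset b}" by blast
  qed
  finally show ?thesis .
qed

lemma lpa_mult: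
  assumes "a \<in> free_alg_carrier E" "b \<in> free_alg_carrier E"
  shows "coset a \<otimes>\<^bsub>L\<^esub> coset b = coset (a * b)"
proof -
  have "coset (x * y) = coset (a * b)" if "x \<in> coset a" "y \<in> coset b" for x y
  proof -
    have xy: "x \<approx> a" "y \<approx> b" using that by (simp_all add: mem_coset)
    have ab: "a \<in> free_alg_unital" "b \<in> free_alg_unital" using assms carrier_subset_unital by blast+
    have "y = (y - b) + b" by simp
    then have "y \<in> free_alg_unital" using xy(2) I_sub ab(2) C_add unfolding cg_def by (metis subsetD)
    then have "x * y \<approx> a * y" using xy by (intro cg_right)
    also have "\<dots> \<approx> a * b" using xy ab by (intro cg_left)
    finally show ?thesis by (simp add: coset_eq_iff)
  qed
  moreover have "a \<in> coset a" "b \<in> coset b" by (simp_all add: mem_coset)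
  moreover have "coset a \<otimes>\<^bsub>L\<^esub> coset b = (\<Union>x\<in>coset a. \<Union>y\<in>coset b. coset (x * y))"
    unfolding leavitt_path_algebra_def FactRing_def rcoset_mult_def
    by (simp add: coset_eq) (simp add: free_alg_ring_def)
  ultimately show ?thesis by blast
qed

lemma lpa_uminus:
  assumes "a \<in> free_alg_carrier E"
  shows "\<ominus>\<^bsub>L\<^esub> coset a = coset (- a)"
proof -
  interpret nonunital_ring L by (rule nonunital_ring_leavitt_path_algebra) unfold_locales
  show ?thesis
  proof (rule minus_equality)
    show "coset (- a) \<oplus>\<^bsub>L\<^esub> coset a = \<zero>\<^bsub>L\<^esub>" by (simp add: lpa_add lpa_zero)
  qed (use assms in \<open>auto simp: lpa_carrier free_alg_carrier_def\<close>)
qed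

lemma graded_lpa:
  assumes "\<forall>r::'r. \<exists>s. r = r * s * r"
  shows "graded_mod (free_alg_carrier E) K hcomp"
proof -
  interpret F: nonunital_ring "free_alg_ring E :: ('v, 'e, 'r) free_alg ring"
    by (rule nonunital_ring_free_alg)
  show ?thesis
  proof
    show "hcomp n x \<in> free_alg_carrier E" if "x \<in> free_alg_carrier E" for n and x :: "('v, 'e, 'r) free_alg"
      using that by (simp add: free_alg_carrier_def keys_hcomp)
    show "- x \<in> free_alg_carrier E" if "x \<in> free_alg_carrier E" for x :: "('v, 'e, 'r) free_alg"
      using that by (simp add: free_alg_carrier_def)
  qed (use F.a_closed F.rng_m_closed F.zero_closed K_carrier lpa_homogeneous_regular[OF assms] in
      \<open>auto simp: free_alg_ring_def hcomp_add hcomp_ideal hcomp_hcomp finite_hcomp sum_hcomp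
        hcomp_mult_left hcomp_mult_right K_uminus intro: lpa_ideal.intros\<close>)
qed

section \<open>Transfer of both properties to the Leavitt path algebra\<close>

lemma lpa_semiprime:
  assumes "\<forall>r::'r. \<exists>s. r = r * s * r"
  shows "semiprime L"
proof -
  interpret G: graded_mod "free_alg_carrier E" K hcomp by (rule graded_lpa[OF assms])
  show ?thesis unfolding semiprime_def
  proof (intro ballI impI)
    fix X assume X: "X \<in> carrier L" "(\<lambda>x. X \<otimes>\<^bsub>L\<^esub> x \<otimes>\<^bsub>L\<^esub> X) ` carrier L = {\<zero>\<^bsub>L\<^esub>}"
    then obtain a where a: "a \<in> free_alg_carrier E" "X = coset a" by (auto simp: lpa_carrier)
    have "a * x * a \<in> K" if x: "x \<in> free_alg_carrier E" for x
    proof -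
      have "coset (a * x * a) = X \<otimes>\<^bsub>L\<^esub> coset x \<otimes>\<^bsub>L\<^esub> X"
        using a x G.C_mult by (simp add: lpa_mult)
      also have "\<dots> = coset 0" using X(2) x by (auto simp: lpa_carrier lpa_zero)
      finally show ?thesis by (simp add: coset_eq_iff cg_def)
    qed
    then have "a \<in> K" by (rule G.graded_semiprime[OF a(1)])
    then show "X = \<zero>\<^bsub>L\<^esub>" by (simp add: a(2) lpa_zero coset_eq_iff cg_def)
  qed
qed

lemma lpa_semiprimitive:
  assumes "\<forall>r::'r. \<exists>s. r = r * s * r"
  shows "semiprimitive L"
proof -
  interpret G: graded_mod "free_alg_carrier E" K hcomp by (rule graded_lpa[OF assms])
  interpret S: nonunital_ring L by (rule nonunital_ring_leavitt_path_algebra) unfold_locales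
  \<comment> \<open>The preimage of the radical, so that the graded argument can run on
    representatives.\<close>
  define J where "J = {a \<in> free_alg_carrier E. coset a \<in> jacobson_radical L}"
  note rad = S.jacobson_left_ideal[unfolded S.is_left_ideal_iff]
  have "J \<subseteq> K"
  proof (rule G.graded_quasi_regular_ideal_trivial)
    show "K \<subseteq> J"
    proof
      fix a assume "a \<in> K"
      then have "coset a = coset 0" by (simp add: coset_eq_iff cg_def)
      then show "a \<in> J" using rad K_carrier \<open>a \<in> K\<close> by (auto simp: J_def lpa_zero)
    qed
    show "J \<subseteq> free_alg_carrier E" by (auto simp: J_def)
    show "x - y \<in> J" if "x \<in> J" "y \<in> J" for x y
    proof -
      have xy: "x \<in> free_alg_carrier E" "y \<in> free_alg_carrier E" "coset x \<in> jacobson_radical L"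
        "coset y \<in> jacobson_radical L" using that by (auto simp: J_def)
      have "coset (x - y) = coset x \<oplus>\<^bsub>L\<^esub> (\<ominus>\<^bsub>L\<^esub> coset y)"
        using xy by (simp add: lpa_uminus lpa_add)
      also have "\<dots> \<in> jacobson_radical L" using rad xy by blast
      finally show ?thesis using xy G.C_diff by (simp add: J_def)
    qed
    show "a * x \<in> J" if "a \<in> free_alg_carrier E" "x \<in> J" for a x
    proof -
      have x: "x \<in> free_alg_carrier E" "coset x \<in> jacobson_radical L" using that by (auto simp: J_def)
      have "coset a \<otimes>\<^bsub>L\<^esub> coset x \<in> jacobson_radical L" using rad x that by (auto simp: lpa_carrier)
      then show ?thesis using x that G.C_mult by (simp add: J_def lpa_mult)
    qed
    show "x * a \<in> J" if "a \<in> free_alg_carrier E" "x \<in> J" for a x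
    proof -
      have x: "x \<in> free_alg_carrier E" "coset x \<in> jacobson_radical L" using that by (auto simp: J_def)
      have "coset x \<otimes>\<^bsub>L\<^esub> coset a \<in> jacobson_radical L"
        using S.jacobson_mult_right[OF x(2)] that by (simp add: lpa_carrier)
      then show ?thesis using x that G.C_mult by (simp add: J_def lpa_mult)
    qed
    show "\<exists>u\<in>free_alg_carrier E. x \<approx> u - u * x" if "x \<in> J" for x
    proof -
      have x: "x \<in> free_alg_carrier E" "coset x \<in> jacobson_radical L" using that by (auto simp: J_def)
      obtain u where u: "u \<in> free_alg_carrier E" "coset x = coset u \<ominus>\<^bsub>L\<^esub> coset u \<otimes>\<^bsub>L\<^esub> coset x"
        using S.jacobson_left_quasi_regular[OF x(2)] by (auto simp: lpa_carrier)
      have "coset x = coset (u - u * x)"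
        using u x G.C_mult by (simp add: a_minus_def lpa_mult lpa_uminus lpa_add)
      then show ?thesis using u(1) by (auto simp: coset_eq_iff)
    qed
  qed
  have "jacobson_radical L \<subseteq> {\<zero>\<^bsub>L\<^esub>}"
  proof
    fix X assume X: "X \<in> jacobson_radical L"
    then have "X \<in> carrier L" using rad by blast
    then obtain a where a: "a \<in> free_alg_carrier E" "X = coset a" by (auto simp: lpa_carrier)
    then have "a \<in> K" using X \<open>J \<subseteq> K\<close> by (auto simp: J_def)
    then show "X \<in> {\<zero>\<^bsub>L\<^esub>}" by (simp add: a(2) lpa_zero coset_eq_iff cg_def)
  qed
  then show ?thesis unfolding semiprimitive_def using rad by blast
qed

end

theorem corollary5p4:
  fixes E :: "('v, 'e) pre_digraph"
  assumes "wf_digraph E"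
    and "\<forall>x::'r::ring_1. \<exists>y. x = x * y * x"
  shows "semiprimitive (leavitt_path_algebra TYPE('r) E) \<and>
    semiprime (leavitt_path_algebra TYPE('r) E)"
proof -
  interpret lpa E "TYPE('r)" using assms(1) by (rule lpa.intro)
  show ?thesis using lpa_semiprimitive lpa_semiprime assms(2) by simp
qed

end
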